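(* Fix an integer $p\ge 3$. Let $h$ be a positive integer such that either $h=1$, or $\gcd(h-1,p)=1$ and $h$ lies in the following range: (a) $2\le h\le (p+1)/2$, if $p$ is odd; (b) $h=2k$ with $1\le k\le l$, if $p=4l$ or $p=4l+2$ with $l$ an integer. Then the equation $A(p,q,r)=h$ has solutions in arbitrarily large $q$ and $r$, which may be taken to be prime; that is, for every $N$ there are primes $q,r>N$ such that $p,q,r$ are pairwise relatively prime and $A(p,q,r)=h$.
   Context: For pairwise relatively prime integers $p,q,r\ge 3$, the ternary inclusion-exclusion polynomial is $$Q_{\{p,q,r\}}(x)=\frac{(x^{pqr}-1)(x^p-1)(x^q-1)(x^r-1)}{(x^{pq}-1)(x^{qr}-1)(x^{rp}-1)(x-1)},$$ which is a polynomial with integer coefficients. $A(p,q,r)$ denotes its height, i.e. the largest absolute value of its coefficients. *)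

theory Defs
  imports "HOL-Computational_Algebra.Computational_Algebra"
begin

(* The denominator is monic and, for pairwise coprime p, q, r >= 1, divides the
   numerator, so div is exact division in int poly here. *)
definition inclusion_exclusion_poly :: "nat \<Rightarrow> nat \<Rightarrow> nat \<Rightarrow> int poly" where
  "inclusion_exclusion_poly p q r =
    ((monom 1 (p * q * r) - 1) * (monom 1 p - 1) * (monom 1 q - 1) * (monom 1 r - 1)) div
    ((monom 1 (p * q) - 1) * (monom 1 (q * r) - 1) * (monom 1 (r * p) - 1) * (monom 1 1 - 1))"

definition poly_height :: "int poly \<Rightarrow> int" where
  "poly_height f = Max ((\<lambda>i. \<bar>coeff f i\<bar>) ` {..degree f})"

definition ternary_height :: "nat \<Rightarrow> nat \<Rightarrow> nat \<Rightarrow> int" where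
  "ternary_height p q r = poly_height (inclusion_exclusion_poly p q r)"

end

theory Submission
  imports Defs "HOL-Number_Theory.Prime_Powers" "HOL-Number_Theory.Cong"
begin

text \<open>
  Put L = h - 1 and choose K > p with L K = 1 mod p; then take primes q = K mod p and r with
  K r = 1 mod p q (for h = 1 take K = L = 1).  Since r inverts K modulo p q, a coefficient of the
  ternary polynomial is a difference of two truncated sums of coefficients of the binary polynomial
  (1 - x)(1 - x^(p q)) / ((1 - x^p)(1 - x^q)) over windows N, N - K, ..., N - (p - 1) K.  The two
  untruncated window sums agree and never both get truncated, so up to sign every coefficient is a
  sum over consecutive terms of one window.  Writing a point as j = q y + p x with 0 <= y < p, such a
  window meets every y once; the positive binary coefficients have y < L, and the negative ones in
  a window have y in a range of L + 1 consecutive values.  Hence all coefficients have modulus at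
  most L + 1, and 2 L + 1 <= p leaves room for a run of L + 1 coefficients -1.

  The primes come from Dirichlet's theorem, proved here without complex characters.  Let W be a
  limit point of the distribution of the residues of n <= N under the weights Lambda(n) / n.  For a
  function f of mean zero on the units let (T f)(g) be the sum of f(g n) / n.  Mertens-type estimates
  say that W annihilates T f, and that W acts as -1 on the kernel of T; since convolution
  with W commutes with T, it maps all functions of mean zero into that kernel.  If W vanished
  somewhere, this would force W to be 2 / phi(m) on the complement of a subgroup of index two and 0
  on the subgroup, giving a real character in the kernel of T, which the hyperbola method excludes.
\<close>

section \<open>Prime number sums\<close>

text \<open>Behind the limit measure \<open>W\<close> stands a dichotomy: its Fourier coefficient at
  a nonprincipal character is -1 if the L-value at 1 vanishes and 0 otherwise. Without characters
  this becomes one identity: with \<open>V\<close> the reflection of \<open>W\<close>, the average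
  of \<open>V (g * b)\<close> against \<open>W\<close> is \<open>2 / \<phi> - V g\<close>.
  Nonnegativity then gives \<open>V g \<le> 2 / \<phi>\<close>, and a zero of \<open>V\<close>
  forces the average to reach this maximum, hence equality on the whole support; this rigidity
  produces the subgroup of index two. For the polynomials, K r = 1 modulo p q turns a unit step in
  the exponent into a step K in the binary index. The row \<open>y j\<close> = L j mod p is the
  coefficient of q in j, as L q = 1 modulo p; a window step lowers it by 1 modulo p, whereas passing
  from j to j - 1 lowers it by L. So L governs the signs and K the order of visits. The prime q
  exceeds K p, so a window is shorter than q. For h > 1 the gcd condition of the theorem is what
  makes L invertible modulo p.\<close>

lemma sum_divisors_swap:
  fixes h :: "nat \<Rightarrow> nat \<Rightarrow> 'a::comm_monoid_add"
  shows "(\<Sum>n=1..N. \<Sum>d | d dvd n. h d (n div d)) = (\<Sum>d=1..N. \<Sum>e=1..N div d. h d e)"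
proof -
  have "(\<Sum>n=1..N. \<Sum>d | d dvd n. h d (n div d))
      = (\<Sum>(n,d)\<in>(SIGMA n:{1..N}. {d. d dvd n}). h d (n div d))"
    by (subst sum.Sigma) (auto intro: finite_divisors_nat)
  also have "\<dots> = (\<Sum>(d,e)\<in>(SIGMA d:{1..N}. {1..N div d}). h d e)"
  proof (rule sum.reindex_bij_witness[where i = "\<lambda>(d,e). (d * e, d)" and j = "\<lambda>(n,d). (d, n div d)"], goal_cases)
    case (2 a)
    obtain n d where a: "a = (n, d)" by (cases a)
    from 2 a have nd: "1 \<le> n" "n \<le> N" "d dvd n" by auto
    then have "1 \<le> d" "d \<le> n" by (auto intro: dvd_imp_le Nat.gr0I simp: Suc_le_eq)
    moreover have "n div d \<le> N div d" using nd by (simp add: div_le_mono)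
    moreover have "1 \<le> n div d"
      using \<open>1 \<le> d\<close> \<open>d \<le> n\<close> by (simp add: Suc_le_eq div_greater_zero_iff)
    ultimately show ?case using a nd by auto
  next
    case (4 b)
    obtain d e where b: "b = (d, e)" by (cases b)
    from 4 b have "1 \<le> d" "1 \<le> e" "e \<le> N div d" by auto
    then have "d * e \<le> N"
      by (metis div_times_less_eq_dividend dual_order.trans mult.commute mult_le_mono2)
    then show ?case using b \<open>1 \<le> d\<close> \<open>1 \<le> e\<close> by auto
  qed auto
  also have "\<dots> = (\<Sum>d=1..N. \<Sum>e=1..N div d. h d e)"
    by (subst sum.Sigma) auto
  finally show ?thesis .
qed

lemma abel_sum_bound:
  fixes f g :: "nat \<Rightarrow> real"
  assumes "M \<le> N"
    and C: "\<And>n. n \<le> N \<Longrightarrow> \<bar>\<Sum>i=M..<n. f i\<bar> \<le> C"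
    and mono: "\<And>i. M \<le> i \<Longrightarrow> i < N \<Longrightarrow> g (Suc i) \<le> g i" and pos: "g N \<ge> 0"
  shows "\<bar>\<Sum>i=M..<N. f i * g i\<bar> \<le> C * g M"
proof -
  \<comment> \<open>Summation by parts as an induction: keeping the boundary term, each step adds a
    partial sum of \<open>f\<close> times a decrement of \<open>g\<close>, and the decrements
    telescope.\<close>
  have "n \<le> N \<longrightarrow> \<bar>(\<Sum>i=M..<n. f i * g i) - (\<Sum>i=M..<n. f i) * g n\<bar> \<le> C * (g M - g n)" if "M \<le> n" for n
    using that
  proof (induction n rule: dec_induct)
    case (step n)
    show ?case
    proof
      assume "Suc n \<le> N"
      let ?S = "\<Sum>i=M..<Suc n. f i"
      have "(\<Sum>i=M..<Suc n. f i * g i) - ?S * g (Suc n)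
          = ((\<Sum>i=M..<n. f i * g i) - (\<Sum>i=M..<n. f i) * g n) + ?S * (g n - g (Suc n))"
        using step.hyps by (simp add: algebra_simps)
      moreover have "\<bar>?S * (g n - g (Suc n))\<bar> \<le> C * (g n - g (Suc n))"
        using C[OF \<open>Suc n \<le> N\<close>] mono[of n] step.hyps \<open>Suc n \<le> N\<close>
        by (auto simp: abs_mult intro!: mult_mono)
      ultimately have "\<bar>(\<Sum>i=M..<Suc n. f i * g i) - ?S * g (Suc n)\<bar>
          \<le> C * (g M - g n) + C * (g n - g (Suc n))"
        using step.IH \<open>Suc n \<le> N\<close> by linarith
      then show "\<bar>(\<Sum>i=M..<Suc n. f i * g i) - ?S * g (Suc n)\<bar> \<le> C * (g M - g (Suc n))"
        by (simp add: algebra_simps)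
    qed
  qed auto
  from this[of N] \<open>M \<le> N\<close>
  have "\<bar>(\<Sum>i=M..<N. f i * g i) - (\<Sum>i=M..<N. f i) * g N\<bar> \<le> C * (g M - g N)" by simp
  moreover have "\<bar>(\<Sum>i=M..<N. f i) * g N\<bar> \<le> C * g N"
    using C[of N] pos by (auto simp: abs_mult intro!: mult_right_mono)
  ultimately show ?thesis by (simp add: algebra_simps)
qed

section \<open>Chebyshev and Mertens estimates\<close>

lemma ln_fact_eq_sum_mangoldt: "ln (fact N :: real) = (\<Sum>d=1..N. mangoldt d * real (N div d))"
proof -
  have "ln (fact N :: real) = (\<Sum>n=1..N. ln (real n))"
    by (simp add: fact_prod) (subst ln_prod, auto)
  also have "\<dots> = (\<Sum>n=1..N. \<Sum>d | d dvd n. mangoldt d)"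
    by (intro sum.cong refl) (simp add: mangoldt_sum)
  also have "\<dots> = (\<Sum>d=1..N. mangoldt d * real (N div d))"
    by (subst sum_divisors_swap[where h = "\<lambda>d e. mangoldt d"]) (simp add: mult.commute)
  finally show ?thesis .
qed

text \<open>Chebyshev's device: the logarithm of the central binomial coefficient weights
  \<open>mangoldt d\<close> by floor(2N/d) - 2 floor(N/d), which is never negative and equals 1 for
  N < d <= 2N.\<close>

lemma sum_mangoldt_double: "(\<Sum>d=1..2*N. mangoldt d) \<le> (\<Sum>d=1..N. mangoldt d) + 2 * real N * ln 2"
proof -
  have eq: "ln (fact N :: real) = (\<Sum>d=1..2*N. mangoldt d * real (N div d))"
    unfolding ln_fact_eq_sum_mangoldt by (rule sum.mono_neutral_left) auto
  have "(\<Sum>d=1..2*N. mangoldt d) - (\<Sum>d=1..N. mangoldt d) = (\<Sum>d\<in>{N<..2*N}. mangoldt d :: real)"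
  proof -
    have "{1..2*N} = {1..N} \<union> {N<..2*N}" by auto
    then have "(\<Sum>d=1..2*N. mangoldt d) = (\<Sum>d=1..N. mangoldt d) + (\<Sum>d\<in>{N<..2*N}. mangoldt d :: real)"
      by (simp only:) (rule sum.union_disjoint, auto)
    then show ?thesis by simp
  qed
  also have "\<dots> \<le> (\<Sum>d\<in>{N<..2*N}. mangoldt d * (real (2*N div d) - 2 * real (N div d)))"
  proof (rule sum_mono)
    fix d assume d: "d \<in> {N<..2*N}"
    then have "2 * N div d = 1" by (intro div_nat_eqI) auto
    then show "mangoldt d \<le> mangoldt d * (real (2*N div d) - 2 * real (N div d))" using d by simp
  qed
  also have "\<dots> \<le> (\<Sum>d=1..2*N. mangoldt d * (real (2*N div d) - 2 * real (N div d)))"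
  proof (rule sum_mono2)
    fix d
    have "2 * (N div d) \<le> 2 * N div d"
      by (cases "d = 0") (auto simp: less_eq_div_iff_mult_less_eq)
    then show "0 \<le> mangoldt d * (real (2*N div d) - 2 * real (N div d))"
      by (intro mult_nonneg_nonneg mangoldt_nonneg) linarith
  qed auto
  also have "\<dots> = ln (fact (2*N)) - 2 * ln (fact N)"
    by (subst eq, subst ln_fact_eq_sum_mangoldt) (simp add: algebra_simps sum_subtractf sum_distrib_left)
  also have "\<dots> = ln (real (2*N choose N))"
    by (subst binomial_fact) (simp_all add: ln_div ln_mult)
  also have "\<dots> \<le> ln (2 ^ (2*N))"
  proof -
    have "2*N choose N \<le> 2 ^ (2*N)" by (rule binomial_le_pow2)
    then have "real (2*N choose N) \<le> 2 ^ (2*N)"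
      by (metis of_nat_le_iff of_nat_numeral of_nat_power)
    then show ?thesis by (subst ln_le_cancel_iff) auto
  qed
  also have "\<dots> = 2 * real N * ln 2" by (simp add: ln_realpow)
  finally show ?thesis by simp
qed

text \<open>Doubling from M = N div 2 gives at most 4M + 2M; the slack up to 8M pays for the extra
  term of an odd N, as \<open>mangoldt N\<close> is at most N - 1 = 2M.\<close>

lemma chebyshev_bound: "(\<Sum>d=1..N. mangoldt d) \<le> 4 * real N"
proof (induction N rule: less_induct)
  case (less N)
  define M where "M = N div 2"
  have ln2: "ln 2 \<le> (1::real)" using ln_2_less_1 by simp
  show ?case
  proof (cases "N \<le> 1")
    case True
    then have "N = 0 \<or> N = 1" by auto
    then show ?thesis by auto
  next
    case False
    then have M: "M < N" by (auto simp: M_def)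
    have 1: "(\<Sum>d=1..2*M. mangoldt d) \<le> 6 * real M"
    proof -
      have "(\<Sum>d=1..2*M. mangoldt d) \<le> 4 * real M + 2 * real M * ln 2"
        using less[OF M] sum_mangoldt_double[of M] by linarith
      also have "2 * real M * ln 2 \<le> 2 * real M * 1" using ln2 by (intro mult_left_mono) auto
      finally show ?thesis by simp
    qed
    show ?thesis
    proof (cases "even N")
      case True
      then have "N = 2 * M" by (auto simp: M_def)
      then show ?thesis using 1 by simp
    next
      case False
      then have N: "N = Suc (2 * M)" by (auto simp: M_def)
      have "mangoldt N \<le> ln (real N)" using N by (intro mangoldt_le) auto
      also have "\<dots> \<le> real N - 1" using N by (intro ln_le_minus_one) auto
      finally have "mangoldt N \<le> 2 * real M" using N by simp
      then show ?thesis using 1 N by simp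
    qed
  qed
qed

lemma ln_fact_lower: "ln (fact N :: real) \<ge> real N * ln (real N) - real N"
proof (induction N)
  case (Suc N)
  show ?case
  proof (cases "N = 0")
    case False
    then have N: "real N > 0" by simp
    have "real N * (ln (real (Suc N)) - ln (real N)) = real N * ln (1 + 1 / real N)"
    proof -
      have "1 + 1 / real N = real (Suc N) / real N" using N by (simp add: field_simps)
      then show ?thesis using N by (simp add: ln_div)
    qed
    also have "\<dots> \<le> real N * (1 / real N)"
      using N by (intro mult_left_mono ln_add_one_self_le_self) auto
    finally have "real N * ln (real (Suc N)) \<le> real N * ln (real N) + 1"
      using N by (simp add: algebra_simps)
    moreover have "ln (fact (Suc N) :: real) = ln (real (Suc N)) + ln (fact N)"
      by (simp add: ln_mult del: of_nat_Suc)
    ultimately show ?thesis using Suc by (simp add: algebra_simps)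
  qed auto
qed auto

text \<open>Removing the floors in the formula for \<open>ln (fact N)\<close> costs at most the sum
  of \<open>mangoldt\<close>, hence 4N, which is the constant 4 after division by N.\<close>

lemma mertens_upper: 
  assumes "N > 0"
  shows "(\<Sum>d=1..N. mangoldt d / real d) \<le> ln (real N) + 4"
proof -
  have "real N * (\<Sum>d=1..N. mangoldt d / real d) = (\<Sum>d=1..N. mangoldt d * (real N / real d))"
    by (simp add: sum_distrib_left mult.commute)
  also have "\<dots> \<le> (\<Sum>d=1..N. mangoldt d * (real (N div d) + 1))"
  proof (intro sum_mono mult_left_mono mangoldt_nonneg)
    fix d :: nat
    show "real N / real d \<le> real (N div d) + 1"
      by (metis floor_divide_of_nat_eq le_add1 of_int_of_nat_eq real_of_int_floor_add_one_ge)
  qed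
  also have "\<dots> = ln (fact N) + (\<Sum>d=1..N. mangoldt d)"
    by (simp add: ln_fact_eq_sum_mangoldt algebra_simps sum.distrib)
  also have "ln (fact N :: real) \<le> ln (real N ^ N)"
    using fact_le_power[of N] assms by (subst ln_le_cancel_iff) (auto simp: fact_less_mono)
  also have "ln (real N ^ N) = real N * ln (real N)" using assms by (simp add: ln_realpow)
  also note chebyshev_bound
  finally have "real N * (\<Sum>d=1..N. mangoldt d / real d) \<le> real N * (ln (real N) + 4)"
    by (simp add: algebra_simps)
  then show ?thesis using assms by simp
qed

lemma mertens_lower:
  assumes "N > 0"
  shows "(\<Sum>d=1..N. mangoldt d / real d) \<ge> ln (real N) - 1"
proof -
  have "real N * (ln (real N) - 1) \<le> ln (fact N)"
    using ln_fact_lower[of N] by (simp add: algebra_simps)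
  also have "\<dots> = (\<Sum>d=1..N. mangoldt d * real (N div d))" by (rule ln_fact_eq_sum_mangoldt)
  also have "\<dots> \<le> (\<Sum>d=1..N. mangoldt d * (real N / real d))"
    by (intro sum_mono mult_left_mono mangoldt_nonneg of_nat_div_le_of_nat) 
  also have "\<dots> = real N * (\<Sum>d=1..N. mangoldt d / real d)"
    by (simp add: sum_distrib_left mult.commute)
  finally show ?thesis using assms by simp
qed

section \<open>Moebius inversion\<close>

definition moebius :: "nat \<Rightarrow> real" where
  "moebius n = (if squarefree n then (-1) ^ card (prime_factors n) else 0)"

lemma abs_moebius_le: "\<bar>moebius n\<bar> \<le> 1"
  by (simp add: moebius_def)

lemma moebius_prime_times:
  assumes "prime p" "\<not> p dvd d" "squarefree d"
  shows "moebius (p * d) = - moebius d"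
proof -
  have "coprime p d" using assms by (simp add: prime_imp_coprime)
  then have "squarefree (p * d)"
    using assms by (simp add: squarefree_mult_coprime squarefree_prime)
  moreover have "d \<noteq> 0" using assms by (auto intro: Nat.gr0I)
  then have "prime_factors (p * d) = insert p (prime_factors d)"
    using assms by (auto simp: prime_factors_product prime_prime_factors)
  moreover have "p \<notin> prime_factors d" using assms by (auto simp: prime_factors_dvd)
  ultimately show ?thesis using assms by (simp add: moebius_def)
qed

lemma sum_moebius:
  assumes "n > 0"
  shows "(\<Sum>d | d dvd n. moebius d) = (if n = 1 then 1 else 0)"
proof (cases "n = 1")
  case False
  then obtain p where p: "prime p" "p dvd n" using prime_factor_nat by blast
  define A where "A = {d. d dvd n \<and> squarefree d \<and> \<not> p dvd d}"
  define B where "B = {d. d dvd n \<and> squarefree d \<and> p dvd d}"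
  have fin: "finite A" "finite B" "finite {d. d dvd n}"
    using assms by (auto simp: A_def B_def)
  have "(\<Sum>d | d dvd n. moebius d) = (\<Sum>d\<in>A \<union> B. moebius d)"
    using fin by (intro sum.mono_neutral_right) (auto simp: A_def B_def moebius_def)
  also have "\<dots> = (\<Sum>d\<in>A. moebius d) + (\<Sum>d\<in>B. moebius d)"
    using fin by (intro sum.union_disjoint) (auto simp: A_def B_def)
  also have "(\<Sum>d\<in>B. moebius d) = (\<Sum>d\<in>A. moebius (p * d))"
  proof (rule sum.reindex_bij_witness[where i = "\<lambda>d. p * d" and j = "\<lambda>d. d div p"])
    fix d assume "d \<in> B"
    then obtain e where e: "d = p * e" "d dvd n" "squarefree d" by (auto simp: B_def)
    have "\<not> p dvd e"
    proof
      assume "p dvd e"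
      then have "p\<^sup>2 dvd d" using e by (auto simp: power2_eq_square)
      then show False using e p by (auto simp: squarefree_def)
    qed
    moreover have "squarefree e" using e squarefree_mono[of e d] by auto
    ultimately show "d div p \<in> A" "p * (d div p) = d" "moebius (p * (d div p)) = moebius d"
      using e p by (auto simp: A_def intro: dvd_mult_right)
  next
    fix d assume "d \<in> A"
    then have d: "d dvd n" "squarefree d" "\<not> p dvd d" by (auto simp: A_def)
    then have "coprime p d" using p by (simp add: prime_imp_coprime)
    then show "p * d \<in> B" using d p
      by (auto simp: B_def divides_mult squarefree_mult_coprime squarefree_prime)
    show "p * d div p = d" using p by auto
  qed
  also have "\<dots> = (\<Sum>d\<in>A. - moebius d)"
    using p by (intro sum.cong refl moebius_prime_times) (auto simp: A_def)
  finally show ?thesis using False by (simp add: sum_negf)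
qed (simp add: moebius_def)

lemma sum_moebius_ln_div:
  assumes "n > 0"
  shows "(\<Sum>d | d dvd n. moebius d * ln (real (n div d))) = mangoldt n"
proof -
  let ?D = "{d. d dvd n}"
  have fin: "finite ?D" using assms by simp
  have D: "{e. e dvd n div d} = {e \<in> ?D. d * e dvd n}" if "d \<in> ?D" for d
    using that assms by (auto simp: dvd_div_iff_mult mult.commute dest: dvd_mult_left)
  have D': "{d. d dvd n div e} = {d \<in> ?D. d * e dvd n}" if "e \<in> ?D" for e
    using D[OF that] by (simp add: mult.commute)
  have "(\<Sum>d\<in>?D. moebius d * ln (real (n div d)))
      = (\<Sum>d\<in>?D. \<Sum>e | e dvd n div d. moebius d * mangoldt e)"
    using assms by (intro sum.cong refl) 
      (auto simp: mangoldt_sum dvd_div_eq_0_iff simp flip: sum_distrib_left)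
  also have "\<dots> = (\<Sum>d\<in>?D. \<Sum>e | e \<in> ?D \<and> d * e dvd n. moebius d * mangoldt e)"
    by (intro sum.cong refl) (simp_all add: D)
  also have "\<dots> = (\<Sum>e\<in>?D. \<Sum>d | d \<in> ?D \<and> d * e dvd n. moebius d * mangoldt e)"
    by (rule sum.swap_restrict[OF fin fin])
  also have "\<dots> = (\<Sum>e\<in>?D. \<Sum>d | d dvd n div e. moebius d * mangoldt e)"
    by (intro sum.cong refl) (simp_all add: D')
  also have "\<dots> = (\<Sum>e\<in>?D. (if e = n then 1 else 0) * mangoldt e)"
  proof (intro sum.cong refl)
    fix e assume "e \<in> ?D"
    then have e: "n div e > 0" "n div e = 1 \<longleftrightarrow> e = n"
      using assms by (auto elim!: dvdE)
    have "(\<Sum>d | d dvd n div e. moebius d * mangoldt e) = (\<Sum>d | d dvd n div e. moebius d) * mangoldt e"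
      by (simp add: sum_distrib_right)
    then show "(\<Sum>d | d dvd n div e. moebius d * mangoldt e) = (if e = n then 1 else 0) * mangoldt e"
      using e by (simp add: sum_moebius)
  qed
  also have "\<dots> = (\<Sum>e\<in>?D. if e = n then mangoldt e else 0)"
    by (intro sum.cong) auto
  also have "\<dots> = mangoldt n" using fin by simp
  finally show ?thesis .
qed

text \<open>The weight ln(N/d), unlike ln(n/d), does not depend on n, so the divisor sum may later
  be exchanged with a sum over n. The price is the extra term at n = 1.\<close>

lemma sum_moebius_ln_quotient:
  assumes "n > 0" "N > 0"
  shows "(\<Sum>d | d dvd n. moebius d * ln (real N / real d))
       = mangoldt n + (if n = 1 then ln (real N) else 0)"
proof -
  have "(\<Sum>d | d dvd n. moebius d * ln (real N / real d))
      = (\<Sum>d | d dvd n. moebius d * ln (real (n div d)) + (ln (real N) - ln (real n)) * moebius d)"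
  proof (intro sum.cong refl)
    fix d assume "d \<in> {d. d dvd n}"
    then have d: "d > 0" "real (n div d) = real n / real d" using assms 
      by (auto simp: real_of_nat_div intro: Nat.gr0I)
    show "moebius d * ln (real N / real d)
      = moebius d * ln (real (n div d)) + (ln (real N) - ln (real n)) * moebius d"
      using d assms by (simp add: ln_div algebra_simps)
  qed
  also have "\<dots> = mangoldt n + (ln (real N) - ln (real n)) * (\<Sum>d | d dvd n. moebius d)"
    using assms by (simp add: sum.distrib sum_moebius_ln_div sum_distrib_left)
  also have "\<dots> = mangoldt n + (if n = 1 then ln (real N) else 0)"
    using assms by (simp add: sum_moebius)
  finally show ?thesis .
qed

section \<open>Bounded contribution of proper prime powers\<close>

lemma sum_power_from_2_le:
  fixes x :: real
  assumes "0 \<le> x" "x \<le> 1/2"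
  shows "(\<Sum>k=2..N. x ^ k) \<le> 2 * x\<^sup>2"
proof (cases "N \<ge> 1")
  case True
  then have "(\<Sum>k=2..N. x ^ k) \<le> 2 * x\<^sup>2 - 2 * x ^ Suc N"
  proof (induction N rule: dec_induct)
    case (step N)
    have "2 * x ^ Suc (Suc N) \<le> x ^ Suc N"
      using mult_right_mono[of "2*x" 1 "x ^ Suc N"] assms by (simp add: mult.assoc)
    then show ?case using step by simp
  qed (simp add: power2_eq_square)
  then show ?thesis using assms by (smt (verit) zero_le_power)
qed auto

text \<open>From ln n = 2 ln(sqrt n) <= 2 sqrt n the left side is at most 2 n^(-3/2), which a
  telescoping difference dominates.\<close>

lemma ln_over_square_le:
  assumes "n \<ge> 2"
  shows "ln (real n) / (real n)\<^sup>2 \<le> 4 * (1 / sqrt (real (n - 1)) - 1 / sqrt (real n))"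
proof -
  define a b where "a = sqrt (real (n - 1))" and "b = sqrt (real n)"
  have ab: "0 < a" "a < b" "a\<^sup>2 = real n - 1" "b\<^sup>2 = real n"
    using assms by (auto simp: a_def b_def)
  have "ln (real n) = 2 * ln b" using assms by (simp add: b_def ln_sqrt)
  also have "\<dots> \<le> 2 * b" using ab ln_le_minus_one[of b] by simp
  finally have "ln (real n) / (real n)\<^sup>2 \<le> 2 * b / (real n)\<^sup>2"
    by (intro divide_right_mono) auto
  also have "\<dots> = 2 / (b * b\<^sup>2)" using ab unfolding ab(4)[symmetric] by (simp add: power2_eq_square)
  also have "\<dots> \<le> 4 * ((b - a) / (a * b))"
  proof -
    have "(b - a) * (b + a) = 1" using ab by (simp add: algebra_simps power2_eq_square)
    then have e: "b - a = 1 / (b + a)" using ab by (simp add: field_simps)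
    have "(b + a) * (a * b) \<le> (2 * b) * (b * b)"
      using ab by (intro mult_mono) auto
    then have "4 / ((2 * b) * (b * b)) \<le> 4 / ((b + a) * (a * b))"
      using ab by (intro divide_left_mono mult_pos_pos) auto
    then have "2 / (b * b\<^sup>2) \<le> 4 / ((b + a) * (a * b))" by (simp add: power2_eq_square)
    then show ?thesis by (simp add: e)
  qed
  also have "(b - a) / (a * b) = 1 / a - 1 / b" using ab by (simp add: field_simps)
  finally show ?thesis by (simp add: a_def b_def)
qed

lemma sum_ln_over_square_le: "(\<Sum>n=2..N. ln (real n) / (real n)\<^sup>2) \<le> 4"
proof (cases "N \<ge> 1")
  case True
  then have "(\<Sum>n=2..N. ln (real n) / (real n)\<^sup>2) \<le> 4 * (1 - 1 / sqrt (real N))"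
  proof (induction N rule: dec_induct)
    case (step N)
    then show ?case using ln_over_square_le[of "Suc N"] by simp
  qed simp
  also have "\<dots> \<le> 4" by simp
  finally show ?thesis .
qed auto

text \<open>Only powers p^k with k >= 2 contribute. The geometric series over k is at most 2/p^2,
  and the remaining sum of ln p / p^2, taken over all integers, is at most 4.\<close>

lemma sum_mangoldt_nonprime_le:
  "(\<Sum>n | n \<in> {1..N} \<and> \<not> prime n. mangoldt n / real n) \<le> 8"
proof -
  define I where "I = {2..N} \<times> {2..N}"
  define A where "A = {n. n \<in> {1..N} \<and> \<not> prime n \<and> primepow n}"
  define g :: "nat \<Rightarrow> real" where "g = (\<lambda>n. mangoldt n / real n)"
  have g0: "g n \<ge> 0" for n by (simp add: g_def mangoldt_nonneg)
  have "(\<Sum>n | n \<in> {1..N} \<and> \<not> prime n. g n) = sum g A"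
    by (rule sum.mono_neutral_right) (auto simp: A_def g_def mangoldt_def)
  also have "\<dots> \<le> sum g ((\<lambda>(p,k). p ^ k) ` {(p,k)\<in>I. prime p})"
  proof (rule sum_mono2)
    show "finite ((\<lambda>(p,k). p ^ k) ` {(p,k)\<in>I. prime p})"
      by (rule finite_imageI, rule finite_subset[of _ I]) (auto simp: I_def)
    show "A \<subseteq> (\<lambda>(p,k). p ^ k) ` {(p,k)\<in>I. prime p}"
    proof
      fix n assume "n \<in> A"
      then obtain p k where pk: "prime p" "k > 0" "n = p ^ k" "n \<le> N" "\<not> prime n"
        by (auto simp: A_def primepow_def)
      then have "k \<noteq> 1" by auto
      then have "k \<ge> 2" using pk by simp
      moreover have "p \<ge> 2" using pk prime_ge_2_nat by blast
      moreover have "p ^ 1 \<le> p ^ k" using pk \<open>p \<ge> 2\<close> by (intro power_increasing) auto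
      moreover have "k < p ^ k" using \<open>p \<ge> 2\<close> by (metis less_exp order_less_le_trans power_mono zero_le)
      ultimately show "n \<in> (\<lambda>(p,k). p ^ k) ` {(p,k)\<in>I. prime p}"
        using pk by (intro image_eqI[of _ _ "(p,k)"]) (auto simp: I_def)
    qed
  qed (use g0 in auto)
  also have "\<dots> \<le> sum (g \<circ> (\<lambda>(p,k). p ^ k)) {(p,k)\<in>I. prime p}"
    by (rule sum_image_le) (auto simp: g0 I_def intro: finite_subset[of _ "{2..N} \<times> {2..N}"])
  also have "\<dots> \<le> (\<Sum>(p,k)\<in>I. ln (real p) * (1 / real p) ^ k)"
    by (rule sum_le_included[where i = id])
       (auto simp: I_def g_def power_divide intro: finite_subset[of _ "{2..N} \<times> {2..N}"])
  also have "\<dots> = (\<Sum>p=2..N. ln (real p) * (\<Sum>k=2..N. (1 / real p) ^ k))"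
    by (simp add: I_def sum.cartesian_product sum_distrib_left)
  also have "\<dots> \<le> (\<Sum>p=2..N. ln (real p) * (2 * (1 / real p)\<^sup>2))"
    by (intro sum_mono mult_left_mono sum_power_from_2_le) (auto simp: field_simps)
  also have "\<dots> = 2 * (\<Sum>n=2..N. ln (real n) / (real n)\<^sup>2)"
    by (simp add: sum_distrib_left power_divide algebra_simps)
  also have "\<dots> \<le> 8" using sum_ln_over_square_le[of N] by simp
  finally show ?thesis by (simp add: g_def)
qed

section \<open>Functions on residue classes\<close>

text \<open>Real functions on the unit group modulo \<open>m\<close>, encoded as functions on all
  naturals (periodic, zero off the units), so that they can be summed directly over
  integers.\<close>

definition residue_fun :: "nat \<Rightarrow> (nat \<Rightarrow> real) \<Rightarrow> bool" where
  "residue_fun m f \<longleftrightarrow> (\<forall>n. f (n mod m) = f n) \<and> (\<forall>n. \<not> coprime n m \<longrightarrow> f n = 0)"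

definition mean_zero :: "nat \<Rightarrow> (nat \<Rightarrow> real) \<Rightarrow> bool" where
  "mean_zero m f \<longleftrightarrow> residue_fun m f \<and> (\<Sum>a<m. f a) = 0"

text \<open>The analogue of an L-value at 1. The infinite sum is meaningful for
  \<open>mean_zero\<close> functions, where \<open>mean_zero_harmonic_sums\<close> supplies
  convergence.\<close>

definition harmonic_value :: "(nat \<Rightarrow> real) \<Rightarrow> real" where
  "harmonic_value f = (\<Sum>n. f (Suc n) / real (Suc n))"

lemma residue_fun_mod: "residue_fun m f \<Longrightarrow> f (n mod m) = f n"
  by (simp add: residue_fun_def)

lemma residue_fun_cong: "residue_fun m f \<Longrightarrow> n mod m = n' mod m \<Longrightarrow> f n = f n'"
  by (metis residue_fun_def)

lemma residue_fun_noncoprime: "residue_fun m f \<Longrightarrow> \<not> coprime n m \<Longrightarrow> f n = 0"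
  by (simp add: residue_fun_def)

lemma residue_fun_shift: "residue_fun m f \<Longrightarrow> residue_fun m (\<lambda>n. f (g * n))"
  unfolding residue_fun_def by (metis coprime_mult_left_iff mod_mult_right_eq)

lemma bij_betw_mult_mod:
  assumes "m > 0" "coprime g m"
  shows "bij_betw (\<lambda>a. g * a mod m) {..<m} {..<m::nat}"
proof -
  have "inj_on (\<lambda>a. g * a mod m) {..<m}"
  proof (rule inj_onI)
    fix a b assume "a \<in> {..<m}" "b \<in> {..<m}" "g * a mod m = g * b mod m"
    then have "[a = b] (mod m)" 
      using assms cong_mult_lcancel_nat[of g m a b] by (simp add: cong_def)
    with \<open>a \<in> _\<close> \<open>b \<in> _\<close> show "a = b" by (simp add: cong_def)
  qed
  moreover have "(\<lambda>a. g * a mod m) ` {..<m} \<subseteq> {..<m}" using assms by auto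
  ultimately show ?thesis by (simp add: bij_betw_def endo_inj_surj)
qed

lemma sum_residue_fun_shift:
  assumes "m > 0" "residue_fun m f" "coprime g m"
  shows "(\<Sum>a<m. f (g * a)) = (\<Sum>a<m. f a)"
proof -
  have "(\<Sum>a<m. f (g * a)) = (\<Sum>a<m. f (g * a mod m))"
    using assms by (simp add: residue_fun_mod)
  also have "\<dots> = (\<Sum>a<m. f a)"
    using sum.reindex_bij_betw[OF bij_betw_mult_mod[OF assms(1,3)], of f] .
  finally show ?thesis .
qed

lemma mean_zero_shift:
  assumes "m > 0" "mean_zero m f"
  shows "mean_zero m (\<lambda>n. f (g * n))"
proof (cases "coprime g m")
  case True
  then show ?thesis using assms 
    by (simp add: mean_zero_def residue_fun_shift sum_residue_fun_shift)
next
  case False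
  then have "f (g * n) = 0" for n
    using assms residue_fun_noncoprime[of m f "g * n"] by (auto simp: mean_zero_def)
  then show ?thesis by (simp add: mean_zero_def residue_fun_def)
qed

lemma residue_fun_bounded:
  assumes "m > 0" "residue_fun m f"
  obtains B where "B > 0" "\<And>n. \<bar>f n\<bar> \<le> B"
proof -
  have "\<bar>f n\<bar> \<le> (\<Sum>a<m. \<bar>f a\<bar>) + 1" for n
  proof -
    have "\<bar>f (n mod m)\<bar> \<le> (\<Sum>a<m. \<bar>f a\<bar>)"
      using assms by (intro member_le_sum) auto
    then show ?thesis using assms by (simp add: residue_fun_mod)
  qed
  moreover have "(\<Sum>a<m. \<bar>f a\<bar>) + 1 > 0" by (smt (verit) sum_nonneg abs_ge_zero)
  ultimately show ?thesis using that by blast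
qed

lemma sum_period:
  assumes "residue_fun m f"
  shows "(\<Sum>i=M..<M+m. f i) = (\<Sum>a<m. f a)"
proof (induction M)
  case 0
  then show ?case by (simp add: atLeast0LessThan)
next
  case (Suc M)
  have "f (M + m) = f M" using assms by (intro residue_fun_cong[of m f]) auto
  moreover have "(\<Sum>i=M..<Suc (M+m). f i) = f M + (\<Sum>i=Suc M..<Suc (M+m). f i)"
    by (rule sum.atLeast_Suc_lessThan) simp
  moreover have "(\<Sum>i=M..<Suc (M+m). f i) = (\<Sum>i=M..<M+m. f i) + f (M + m)" by simp
  ultimately show ?case using Suc by simp
qed

text \<open>Complete periods cancel, leaving fewer than \<open>m\<close> terms.\<close>

lemma mean_zero_sum_bound:
  assumes "m > 0" "mean_zero m f" "\<And>n. \<bar>f n\<bar> \<le> B"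
  shows "\<bar>\<Sum>i=M..<N. f i\<bar> \<le> real m * B"
proof (induction "N - M" arbitrary: M rule: less_induct)
  case less
  have B: "B \<ge> 0" using assms(3)[of 0] by linarith
  show ?case
  proof (cases "M + m \<le> N")
    case True
    have "(\<Sum>i=M..<N. f i) = (\<Sum>i=M..<M+m. f i) + (\<Sum>i=M+m..<N. f i)"
      using True by (simp add: sum.atLeastLessThan_concat)
    also have "(\<Sum>i=M..<M+m. f i) = 0" using sum_period assms by (simp add: mean_zero_def)
    finally show ?thesis using less[of "M + m"] True assms(1) by simp
  next
    case False
    have "\<bar>\<Sum>i=M..<N. f i\<bar> \<le> (\<Sum>i=M..<N. \<bar>f i\<bar>)" by (rule sum_abs)
    also have "\<dots> \<le> real (card {M..<N}) * B" using assms by (intro sum_bounded_above) auto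
    also have "\<dots> \<le> real m * B" using False B by (intro mult_right_mono) auto
    finally show ?thesis .
  qed
qed

lemma mean_zero_abel:
  assumes "m > 0" "mean_zero m f" "\<And>n. \<bar>f n\<bar> \<le> B"
    and "\<And>i. M \<le> i \<Longrightarrow> g (Suc i) \<le> g i" and "\<And>i. M \<le> i \<Longrightarrow> g i \<ge> 0"
  shows "\<bar>\<Sum>i=M..<N. f i * g i\<bar> \<le> real m * B * g M"
proof (cases "M \<le> N")
  case True
  then show ?thesis using assms by (intro abel_sum_bound mean_zero_sum_bound) auto
next
  case False
  have B: "B \<ge> 0" using assms(3)[of 0] by linarith
  show ?thesis using False assms(5)[of M] B by auto
qed

lemma mean_zero_harmonic_bound:
  assumes "m > 0" "mean_zero m f" "\<And>n. \<bar>f n\<bar> \<le> B"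
  shows "\<bar>\<Sum>i=Suc M..<N. f i / real i\<bar> \<le> real m * B / real (Suc M)"
  using mean_zero_abel[OF assms, of "Suc M" "\<lambda>i. 1 / real i" N]
  by (simp add: frac_le)

lemma mean_zero_harmonic_sums:
  assumes "m > 0" "mean_zero m f"
  shows "(\<lambda>n. f (Suc n) / real (Suc n)) sums harmonic_value f"
proof -
  obtain B where B: "B > 0" "\<And>n. \<bar>f n\<bar> \<le> B"
    using residue_fun_bounded assms unfolding mean_zero_def by blast
  have "summable (\<lambda>n. f (Suc n) / real (Suc n))"
    unfolding summable_Cauchy
  proof (intro allI impI)
    fix e :: real assume "e > 0"
    obtain K :: nat where K: "real m * B / e < real K" using reals_Archimedean2 by blast
    have "norm (\<Sum>i=M..<N. f (Suc i) / real (Suc i)) < e" if "M \<ge> K" for M N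
    proof -
      have "(\<Sum>i=M..<N. f (Suc i) / real (Suc i)) = (\<Sum>i=Suc M..<Suc N. f i / real i)"
        by (rule sum.shift_bounds_Suc_ivl[symmetric])
      then have "norm (\<Sum>i=M..<N. f (Suc i) / real (Suc i)) \<le> real m * B / real (Suc M)"
        using mean_zero_harmonic_bound[OF assms B(2), of M "Suc N"] by (simp only: real_norm_def)
      also have "\<dots> < e"
      proof -
        have "real m * B / e < real (Suc M)" using K that by linarith
        then show ?thesis using \<open>e > 0\<close> by (simp add: field_simps)
      qed
      finally show ?thesis .
    qed
    then show "\<exists>K. \<forall>M\<ge>K. \<forall>N. norm (\<Sum>i=M..<N. f (Suc i) / real (Suc i)) < e" by blast
  qed
  then show ?thesis unfolding harmonic_value_def by (rule summable_sums)
qed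

lemma mean_zero_harmonic_tail:
  assumes "m > 0" "mean_zero m f" "\<And>n. \<bar>f n\<bar> \<le> B"
  shows "\<bar>(\<Sum>i=1..N. f i / real i) - harmonic_value f\<bar> \<le> real m * B / real (Suc N)"
proof -
  have "(\<lambda>K. \<Sum>n<K. f (Suc n) / real (Suc n)) \<longlonglongrightarrow> harmonic_value f"
    using mean_zero_harmonic_sums[OF assms(1,2)] by (simp add: sums_def)
  then have "(\<lambda>K. \<bar>(\<Sum>i=1..N. f i / real i) - (\<Sum>n<K. f (Suc n) / real (Suc n))\<bar>)
      \<longlonglongrightarrow> \<bar>(\<Sum>i=1..N. f i / real i) - harmonic_value f\<bar>"
    by (intro tendsto_intros)
  then show ?thesis
  proof (rule Lim_bounded[where M = N], intro allI impI)
    fix K assume "N \<le> K"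
    have "(\<Sum>n<K. f (Suc n) / real (Suc n)) = (\<Sum>i=Suc 0..<Suc K. f i / real i)"
      unfolding lessThan_atLeast0 by (rule sum.shift_bounds_Suc_ivl[symmetric])
    also have "\<dots> = (\<Sum>i=Suc 0..<Suc N. f i / real i) + (\<Sum>i=Suc N..<Suc K. f i / real i)"
      using \<open>N \<le> K\<close> by (subst sum.atLeastLessThan_concat) auto
    finally have "\<bar>(\<Sum>i=1..N. f i / real i) - (\<Sum>n<K. f (Suc n) / real (Suc n))\<bar>
        = \<bar>\<Sum>i=Suc N..<Suc K. f i / real i\<bar>"
      by (simp add: atLeastLessThanSuc_atLeastAtMost)
    also have "\<dots> \<le> real m * B / real (Suc N)" by (rule mean_zero_harmonic_bound[OF assms])
    finally show "\<bar>(\<Sum>i=1..N. f i / real i) - (\<Sum>n<K. f (Suc n) / real (Suc n))\<bar>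
        \<le> real m * B / real (Suc N)" .
  qed
qed

text \<open>The error is proportional to d/N, so weights \<open>mangoldt d / real d\<close> turn it
  into a Chebyshev sum divided by N.\<close>

lemma mean_zero_harmonic_tail_div:
  assumes "m > 0" "mean_zero m f" "\<And>n. \<bar>f n\<bar> \<le> B" "1 \<le> d" "d \<le> N"
  shows "\<bar>(\<Sum>e=1..N div d. f (d * e) / real e) - harmonic_value (\<lambda>n. f (d * n))\<bar>
       \<le> real m * B * real d / real N"
proof -
  have "\<bar>(\<Sum>e=1..N div d. f (d * e) / real e) - harmonic_value (\<lambda>n. f (d * n))\<bar>
      \<le> real m * B / real (Suc (N div d))"
    using assms by (intro mean_zero_harmonic_tail mean_zero_shift) auto
  also have "\<dots> \<le> real m * B / (real N / real d)"
  proof (rule divide_left_mono)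
    have "N < d * Suc (N div d)" using assms(4) by (simp add: dividend_less_times_div)
    then have "real N \<le> real d * real (Suc (N div d))" 
      by (metis of_nat_le_iff of_nat_mult less_imp_le)
    then show "real N / real d \<le> real (Suc (N div d))" using assms by (simp add: field_simps)
    show "0 \<le> real m * B" using assms(3)[of 0] by auto
  qed (use assms in auto)
  finally show ?thesis by simp
qed

section \<open>Mertens-type estimates for functions of mean zero\<close>

lemma ln_over_antimono:
  assumes "n \<ge> 3"
  shows "ln (real (Suc n)) / real (Suc n) \<le> ln (real n) / real n"
proof -
  have n: "real n > 0" using assms by simp
  have "real n * (ln (real (Suc n)) - ln (real n)) = real n * ln (1 + 1 / real n)"
  proof -
    have "1 + 1 / real n = real (Suc n) / real n" using n by (simp add: field_simps)
    then show ?thesis using n by (simp add: ln_div)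
  qed
  also have "\<dots> \<le> real n * (1 / real n)"
    using n by (intro mult_left_mono ln_add_one_self_le_self) auto
  also have "\<dots> = 1" using n by simp
  also have "1 \<le> ln (real n)"
    using exp_le assms n by (subst ln_ge_iff) auto
  finally show ?thesis using n by (simp add: field_simps)
qed

lemma mean_zero_ln_bounded:
  assumes "m > 0" "mean_zero m f"
  obtains C where "\<And>N. \<bar>\<Sum>n=1..N. f n * (ln (real n) / real n)\<bar> \<le> C"
proof -
  obtain B where B: "B > 0" "\<And>n. \<bar>f n\<bar> \<le> B"
    using residue_fun_bounded assms unfolding mean_zero_def by blast
  let ?g = "\<lambda>n. ln (real n) / real n"
  \<comment> \<open>The weight ln n / n decreases only from 3 on, as e < 3, so the terms below 3 are
    split off.\<close>
  have "\<bar>\<Sum>n=1..N. f n * ?g n\<bar> \<le> \<bar>\<Sum>n=1..<3. f n * ?g n\<bar> + real m * B * ?g 3" for N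
  proof (cases "N \<ge> 2")
    case True
    have "(\<Sum>n=1..N. f n * ?g n) = (\<Sum>n=1..<3. f n * ?g n) + (\<Sum>n=3..<Suc N. f n * ?g n)"
      using True by (subst sum.atLeastLessThan_concat) (auto simp: atLeastLessThanSuc_atLeastAtMost)
    moreover have "\<bar>\<Sum>n=3..<Suc N. f n * ?g n\<bar> \<le> real m * B * ?g 3"
      using mean_zero_abel[OF assms B(2), of 3 ?g "Suc N"] ln_over_antimono by simp
    ultimately show ?thesis by linarith
  next
    case False
    then have "N = 0 \<or> N = 1" by auto
    then have "(\<Sum>n=1..N. f n * ?g n) = 0" by auto
    then show ?thesis using B by simp
  qed
  then show ?thesis using that by blast
qed

text \<open>Expand ln n into \<open>mangoldt\<close> over divisors in the bounded sum of f(n) ln n /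
  n, then replace each inner sum by its limit; Chebyshev's bound absorbs the errors. After division
  by ln N this says that \<open>W\<close> annihilates the harmonic values of the shifts of
  \<open>f\<close>.\<close>

lemma sum_mangoldt_harmonic_value_bounded:
  assumes "m > 0" "mean_zero m f"
  obtains C where
    "\<And>N. N > 0 \<Longrightarrow> \<bar>\<Sum>d=1..N. mangoldt d / real d * harmonic_value (\<lambda>n. f (d * n))\<bar> \<le> C"
proof -
  obtain B where B: "B > 0" "\<And>n. \<bar>f n\<bar> \<le> B"
    using residue_fun_bounded assms unfolding mean_zero_def by blast
  obtain C where C: "\<And>N. \<bar>\<Sum>n=1..N. f n * (ln (real n) / real n)\<bar> \<le> C"
    using mean_zero_ln_bounded[OF assms] by blast
  have "\<bar>\<Sum>d=1..N. mangoldt d / real d * harmonic_value (\<lambda>n. f (d * n))\<bar> \<le> C + 4 * real m * B"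
    if "N > 0" for N
  proof -
    define S where "S d = (\<Sum>e=1..N div d. f (d * e) / real e)" for d
    have "(\<Sum>n=1..N. f n * (ln (real n) / real n))
        = (\<Sum>n=1..N. \<Sum>d | d dvd n. mangoldt d / real d * (f (d * (n div d)) / real (n div d)))"
    proof (rule sum.cong[OF refl])
      fix n assume "n \<in> {1..N}"
      then have "n > 0" by simp
      then have "f n * (ln (real n) / real n) = (\<Sum>d | d dvd n. mangoldt d * (f n / real n))"
        by (subst sum_distrib_right[symmetric]) (simp add: mangoldt_sum)
      also have "\<dots> = (\<Sum>d | d dvd n. mangoldt d / real d * (f (d * (n div d)) / real (n div d)))"
        by (rule sum.cong) (auto simp: real_of_nat_div)
      finally show "f n * (ln (real n) / real n)
         = (\<Sum>d | d dvd n. mangoldt d / real d * (f (d * (n div d)) / real (n div d)))" .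
    qed
    also have "\<dots> = (\<Sum>d=1..N. mangoldt d / real d * S d)"
      by (subst sum_divisors_swap[where h = "\<lambda>d e. mangoldt d / real d * (f (d * e) / real e)"])
         (simp add: S_def sum_distrib_left)
    finally have eq: "(\<Sum>n=1..N. f n * (ln (real n) / real n)) = (\<Sum>d=1..N. mangoldt d / real d * S d)" .
    have "\<bar>(\<Sum>d=1..N. mangoldt d / real d * S d)
          - (\<Sum>d=1..N. mangoldt d / real d * harmonic_value (\<lambda>n. f (d * n)))\<bar>
        = \<bar>\<Sum>d=1..N. mangoldt d / real d * (S d - harmonic_value (\<lambda>n. f (d * n)))\<bar>"
      by (simp add: sum_subtractf right_diff_distrib)
    also have "\<dots> \<le> (\<Sum>d=1..N. mangoldt d * (real m * B / real N))"
    proof (rule order_trans[OF sum_abs sum_mono])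
      fix d assume d: "d \<in> {1..N}"
      have "\<bar>mangoldt d / real d * (S d - harmonic_value (\<lambda>n. f (d * n)))\<bar>
          = mangoldt d / real d * \<bar>S d - harmonic_value (\<lambda>n. f (d * n))\<bar>"
        by (simp add: abs_mult mangoldt_nonneg)
      also have "\<dots> \<le> mangoldt d / real d * (real m * B * real d / real N)"
        unfolding S_def using d
        by (intro mult_left_mono mean_zero_harmonic_tail_div assms B) (auto simp: mangoldt_nonneg)
      also have "\<dots> = mangoldt d * (real m * B / real N)" using d by simp
      finally show "\<bar>mangoldt d / real d * (S d - harmonic_value (\<lambda>n. f (d * n)))\<bar>
          \<le> mangoldt d * (real m * B / real N)" .
    qed
    also have "\<dots> = (\<Sum>d=1..N. mangoldt d) * (real m * B / real N)" by (rule sum_distrib_right[symmetric])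
    also have "\<dots> \<le> (4 * real N) * (real m * B / real N)"
      using B by (intro mult_right_mono chebyshev_bound) auto
    also have "\<dots> = 4 * real m * B" using that by simp
    finally show ?thesis using C[of N] eq by linarith
  qed
  then show ?thesis using that by blast
qed

text \<open>Since all harmonic values vanish, every inner sum is just a tail of size O(d/N). The sum
  of ln(N/d) over d <= N is at most N, so the total stays bounded. After division by ln N the
  averages of \<open>f\<close> against \<open>W\<close> equal \<open>- f 1\<close>.\<close>

lemma sum_mangoldt_of_harmonic_zero:
  assumes "m > 0" "mean_zero m f" and zero: "\<And>g. harmonic_value (\<lambda>n. f (g * n)) = 0"
  obtains C where "\<And>N. N > 0 \<Longrightarrow> \<bar>(\<Sum>n=1..N. f n * mangoldt n / real n) + f 1 * ln (real N)\<bar> \<le> C"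
proof -
  obtain B where B: "B > 0" "\<And>n. \<bar>f n\<bar> \<le> B"
    using residue_fun_bounded assms unfolding mean_zero_def by blast
  have "\<bar>(\<Sum>n=1..N. f n * mangoldt n / real n) + f 1 * ln (real N)\<bar> \<le> real m * B"
    if "N > 0" for N
  proof -
    let ?l = "\<lambda>d. ln (real N / real d)"
    define S where "S d = (\<Sum>e=1..N div d. f (d * e) / real e)" for d
    have "(\<Sum>n=1..N. f n * mangoldt n / real n) + f 1 * ln (real N)
        = (\<Sum>n=1..N. f n * mangoldt n / real n) + (\<Sum>n=1..N. if n = 1 then f n * ln (real N) / real n else 0)"
      using that by simp
    also have "\<dots> = (\<Sum>n=1..N. f n / real n * (mangoldt n + (if n = 1 then ln (real N) else 0)))"
      unfolding sum.distrib[symmetric] by (rule sum.cong) (auto simp: algebra_simps)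
    also have "\<dots> = (\<Sum>n=1..N. \<Sum>d | d dvd n. moebius d * ?l d / real d * (f (d * (n div d)) / real (n div d)))"
    proof (rule sum.cong[OF refl])
      fix n assume "n \<in> {1..N}"
      then have "n > 0" by simp
      then have "f n / real n * (mangoldt n + (if n = 1 then ln (real N) else 0))
          = (\<Sum>d | d dvd n. f n / real n * (moebius d * ?l d))"
        using sum_moebius_ln_quotient[of n N] that by (subst sum_distrib_left[symmetric]) simp
      also have "\<dots> = (\<Sum>d | d dvd n. moebius d * ?l d / real d * (f (d * (n div d)) / real (n div d)))"
        by (rule sum.cong) (auto simp: real_of_nat_div)
      finally show "f n / real n * (mangoldt n + (if n = 1 then ln (real N) else 0))
         = (\<Sum>d | d dvd n. moebius d * ?l d / real d * (f (d * (n div d)) / real (n div d)))" .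
    qed
    also have "\<dots> = (\<Sum>d=1..N. moebius d * ?l d / real d * S d)"
      by (subst sum_divisors_swap[where h = "\<lambda>d e. moebius d * ?l d / real d * (f (d * e) / real e)"])
         (simp add: S_def sum_distrib_left)
    also have "\<bar>\<dots>\<bar> \<le> (\<Sum>d=1..N. ?l d * (real m * B / real N))"
    proof (rule order_trans[OF sum_abs sum_mono])
      fix d assume d: "d \<in> {1..N}"
      have l: "?l d \<ge> 0" using d by simp
      have "\<bar>S d\<bar> \<le> real m * B * real d / real N"
        using mean_zero_harmonic_tail_div[OF assms(1,2) B(2), of d N] zero d by (simp add: S_def)
      then have "\<bar>moebius d\<bar> * (?l d / real d) * \<bar>S d\<bar> \<le> 1 * (?l d / real d) * (real m * B * real d / real N)"
        using l abs_moebius_le by (intro mult_mono) auto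
      also have "\<dots> = ?l d * (real m * B / real N)" using d by simp
      finally show "\<bar>moebius d * ?l d / real d * S d\<bar> \<le> ?l d * (real m * B / real N)"
        using l by (simp add: abs_mult)
    qed
    also have "\<dots> = (\<Sum>d=1..N. ?l d) * (real m * B / real N)" by (rule sum_distrib_right[symmetric])
    also have "(\<Sum>d=1..N. ?l d) = (\<Sum>d=1..N. ln (real N) - ln (real d))"
      using that by (intro sum.cong) (auto simp: ln_div)
    also have "\<dots> = real N * ln (real N) - ln (fact N)"
      by (simp add: sum_subtractf fact_prod) (subst ln_prod, auto)
    also have "(real N * ln (real N) - ln (fact N)) * (real m * B / real N) \<le> real N * (real m * B / real N)"
      using ln_fact_lower[of N] B by (intro mult_right_mono) auto
    also have "\<dots> = real m * B" using that by simp
    finally show ?thesis .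
  qed
  then show ?thesis using that by blast
qed

text \<open>An n that is not coprime to \<open>m\<close> is either not prime, contributing at most 8
  in total, or a prime divisor of \<open>m\<close>, hence at most \<open>m\<close>.\<close>

lemma sum_mangoldt_coprime:
  assumes "m > 0"
  obtains C where
    "\<And>N. N > 0 \<Longrightarrow> \<bar>(\<Sum>n | n \<in> {1..N} \<and> coprime n m. mangoldt n / real n) - ln (real N)\<bar> \<le> C"
proof -
  define D where "D = (\<Sum>n=1..m. mangoldt n / real n)"
  have "\<bar>(\<Sum>n | n \<in> {1..N} \<and> coprime n m. mangoldt n / real n) - ln (real N)\<bar> \<le> 4 + 8 + D"
    if "N > 0" for N
  proof -
    let ?g = "\<lambda>n. mangoldt n / real n"
    have g: "?g n \<ge> 0" for n by (simp add: mangoldt_nonneg)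
    let ?X = "{n. n \<in> {1..N} \<and> \<not> coprime n m}"
    have "{1..N} = {n. n \<in> {1..N} \<and> coprime n m} \<union> ?X" by auto
    then have "sum ?g {1..N} = sum ?g ({n. n \<in> {1..N} \<and> coprime n m} \<union> ?X)"
      by (rule arg_cong)
    also have "\<dots> = sum ?g {n. n \<in> {1..N} \<and> coprime n m} + sum ?g ?X"
      by (rule sum.union_disjoint) auto
    finally have 1: "sum ?g {1..N} = sum ?g {n. n \<in> {1..N} \<and> coprime n m} + sum ?g ?X" .
    have "?X \<subseteq> {n. n \<in> {1..N} \<and> \<not> prime n} \<union> {1..m}"
    proof
      fix n assume n: "n \<in> ?X"
      show "n \<in> {n. n \<in> {1..N} \<and> \<not> prime n} \<union> {1..m}"
      proof (cases "prime n")
        case True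
        then have "n dvd m" using n prime_imp_coprime by blast
        then show ?thesis using assms n by (auto dest: dvd_imp_le)
      qed (use n in auto)
    qed
    then have "sum ?g ?X \<le> sum ?g ({n. n \<in> {1..N} \<and> \<not> prime n} \<union> {1..m})"
      using g by (intro sum_mono2) auto
    also have "\<dots> \<le> sum ?g {n. n \<in> {1..N} \<and> \<not> prime n} + sum ?g {1..m}"
      using g by (subst sum_Un) (auto intro: sum_nonneg)
    also have "\<dots> \<le> 8 + D"
      using sum_mangoldt_nonprime_le[of N] by (simp add: D_def)
    finally have 2: "sum ?g ?X \<le> 8 + D" .
    have "sum ?g ?X \<ge> 0" "D \<ge> 0" using g by (auto intro: sum_nonneg simp: D_def)
    then show ?thesis using 1 2 mertens_upper[OF that] mertens_lower[OF that] by linarith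
  qed
  then show ?thesis using that by blast
qed

section \<open>Real characters\<close>

text \<open>Divisors of p^(k+1) n prime to p are the divisors of n; the others are p times the
  divisors of p^k n.\<close>

lemma divisor_sum_prime_power:
  fixes \<chi> :: "nat \<Rightarrow> real"
  assumes mult: "\<And>a b. \<chi> (a * b) = \<chi> a * \<chi> b" and p: "prime p" "\<not> p dvd n" "n > 0"
  shows "(\<Sum>d | d dvd p ^ Suc k * n. \<chi> d) = (\<Sum>d | d dvd n. \<chi> d) + \<chi> p * (\<Sum>d | d dvd p ^ k * n. \<chi> d)"
proof -
  have p0: "p > 0" using p prime_gt_0_nat by blast
  have eq: "{d. d dvd p ^ Suc k * n} = {d. d dvd n} \<union> (\<lambda>d. p * d) ` {d. d dvd p ^ k * n}"
  proof (intro equalityI subsetI)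
    fix d assume d: "d \<in> {d. d dvd p ^ Suc k * n}"
    show "d \<in> {d. d dvd n} \<union> (\<lambda>d. p * d) ` {d. d dvd p ^ k * n}"
    proof (cases "p dvd d")
      case True
      then show ?thesis using d p0 by (auto simp: mult.assoc elim!: dvdE)
    next
      case False
      then have "coprime d (p ^ Suc k)" using p 
        by (metis coprime_commute coprime_power_right_iff prime_imp_coprime)
      then show ?thesis using d coprime_dvd_mult_right_iff by blast
    qed
  qed (auto simp: mult.assoc)
  have "(\<Sum>d | d dvd p ^ Suc k * n. \<chi> d)
      = (\<Sum>d | d dvd n. \<chi> d) + (\<Sum>d\<in>(\<lambda>d. p * d) ` {d. d dvd p ^ k * n}. \<chi> d)"
    unfolding eq using p p0 by (intro sum.union_disjoint) auto
  also have "(\<Sum>d\<in>(\<lambda>d. p * d) ` {d. d dvd p ^ k * n}. \<chi> d) = (\<Sum>d | d dvd p ^ k * n. \<chi> (p * d))"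
    using p0 by (subst sum.reindex) (auto simp: inj_on_def)
  finally show ?thesis by (simp add: mult sum_distrib_left)
qed

text \<open>Nonnegativity alone is not inductive when \<open>\<chi> p = -1\<close>: there the sums
  alternate between the value for n and 0, so the exact alternation is carried along.\<close>

lemma divisor_sum_prime_power_bounds:
  fixes \<chi> :: "nat \<Rightarrow> real"
  assumes mult: "\<And>a b. \<chi> (a * b) = \<chi> a * \<chi> b" and vals: "\<And>n. \<chi> n \<in> {-1, 0, 1}"
    and p: "prime p" "\<not> p dvd n" "n > 0" and nonneg: "(\<Sum>d | d dvd n. \<chi> d) \<ge> 0"
  shows "(\<Sum>d | d dvd p ^ k * n. \<chi> d) \<ge> 0 \<and>
    (even k \<longrightarrow> (\<Sum>d | d dvd p ^ k * n. \<chi> d) \<ge> (\<Sum>d | d dvd n. \<chi> d)) \<and>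
    (\<chi> p = -1 \<longrightarrow> (\<Sum>d | d dvd p ^ k * n. \<chi> d) = (if even k then \<Sum>d | d dvd n. \<chi> d else 0))"
proof (induction k)
  case (Suc k)
  show ?case
    using Suc nonneg vals[of p] unfolding divisor_sum_prime_power[OF mult p] by auto
qed (use nonneg in simp)

lemma divisor_sum_nonneg:
  fixes \<chi> :: "nat \<Rightarrow> real"
  assumes "\<And>a b. \<chi> (a * b) = \<chi> a * \<chi> b" "\<And>n. \<chi> n \<in> {-1, 0, 1}" "\<chi> 1 = 1" "n > 0"
  shows "(\<Sum>d | d dvd n. \<chi> d) \<ge> 0"
  using \<open>n > 0\<close>
proof (induction n rule: less_induct)
  case (less n)
  show ?case
  proof (cases "n = 1")
    case False
    then obtain p where p: "prime p" "p dvd n" using prime_factor_nat by blast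
    then have "\<not> is_unit p" by auto
    then obtain n' where n': "n = p ^ multiplicity p n * n'" "\<not> p dvd n'"
      using multiplicity_decompose'[of n p] less.prems by auto
    have "multiplicity p n > 0" using p less.prems by (simp add: prime_multiplicity_gt_zero_iff)
    then have "p ^ multiplicity p n > 1" using prime_gt_1_nat[OF p(1)] by (simp only: one_less_power)
    moreover have "n' > 0" using n' by (intro Nat.gr0I) auto
    ultimately have "1 * n' < p ^ multiplicity p n * n'" by (intro mult_strict_right_mono)
    then have "n' < n" by (simp only: n'(1)[symmetric] mult_1)
    then have "(\<Sum>d | d dvd n'. \<chi> d) \<ge> 0" using less.IH \<open>n' > 0\<close> by blast
    from divisor_sum_prime_power_bounds[OF assms(1,2) p(1) n'(2) \<open>n' > 0\<close> this, of "multiplicity p n"]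
    show ?thesis using n'(1) by simp
  qed (use assms in simp)
qed

lemma divisor_sum_square_ge_1:
  fixes \<chi> :: "nat \<Rightarrow> real"
  assumes "\<And>a b. \<chi> (a * b) = \<chi> a * \<chi> b" "\<And>n. \<chi> n \<in> {-1, 0, 1}" "\<chi> 1 = 1" "n > 0"
  shows "(\<Sum>d | d dvd n\<^sup>2. \<chi> d) \<ge> 1"
  using \<open>n > 0\<close>
proof (induction n rule: less_induct)
  case (less n)
  show ?case
  proof (cases "n = 1")
    case False
    then obtain p where p: "prime p" "p dvd n" using prime_factor_nat by blast
    then have "\<not> is_unit p" by auto
    then obtain n' where n': "n = p ^ multiplicity p n * n'" "\<not> p dvd n'"
      using multiplicity_decompose'[of n p] less.prems by auto
    have "multiplicity p n > 0" using p less.prems by (simp add: prime_multiplicity_gt_zero_iff)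
    then have "p ^ multiplicity p n > 1" using prime_gt_1_nat[OF p(1)] by (simp only: one_less_power)
    moreover have "n' > 0" using n' by (intro Nat.gr0I) auto
    ultimately have "1 * n' < p ^ multiplicity p n * n'" by (intro mult_strict_right_mono)
    then have "n' < n" by (simp only: n'(1)[symmetric] mult_1)
    then have 1: "(\<Sum>d | d dvd n'\<^sup>2. \<chi> d) \<ge> 1" using less.IH \<open>n' > 0\<close> by blast
    have "\<not> p dvd n'\<^sup>2" using n' p by (auto dest: prime_dvd_power)
    moreover have "n'\<^sup>2 > 0" using \<open>n' > 0\<close> by simp
    ultimately have "(\<Sum>d | d dvd p ^ (2 * multiplicity p n) * n'\<^sup>2. \<chi> d) \<ge> (\<Sum>d | d dvd n'\<^sup>2. \<chi> d)"
      using divisor_sum_prime_power_bounds[OF assms(1,2) p(1), of "n'\<^sup>2" "2 * multiplicity p n"] 1 by auto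
    moreover have "n\<^sup>2 = p ^ (2 * multiplicity p n) * n'\<^sup>2"
      by (subst n'(1)) (simp add: power_mult_distrib power_mult[symmetric] mult.commute)
    ultimately show ?thesis using 1 by simp
  qed (use assms in simp)
qed

lemma sqrt_Suc_diff_bounds:
  assumes "n \<ge> 1"
  shows "1 / sqrt (real (Suc n)) \<le> 2 * (sqrt (real (Suc n)) - sqrt (real n))"
    and "2 * (sqrt (real (Suc n)) - sqrt (real n)) \<le> 1 / sqrt (real n)"
proof -
  define a b where "a = sqrt (real n)" and "b = sqrt (real (Suc n))"
  have ab: "0 < a" "a < b" "a\<^sup>2 = real n" "b\<^sup>2 = real n + 1"
    using assms by (auto simp: a_def b_def)
  have "(b - a) * (b + a) = 1" using ab by (simp add: algebra_simps power2_eq_square)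
  then have e: "b - a = 1 / (b + a)" using ab by (simp add: field_simps)
  have "1 / (2 * b) \<le> 1 / (b + a)" "1 / (b + a) \<le> 1 / (2 * a)"
    using ab by (auto intro!: divide_left_mono)
  then show "1 / sqrt (real (Suc n)) \<le> 2 * (sqrt (real (Suc n)) - sqrt (real n))"
    and "2 * (sqrt (real (Suc n)) - sqrt (real n)) \<le> 1 / sqrt (real n)"
    unfolding a_def[symmetric] b_def[symmetric] e by auto
qed

text \<open>The difference \<open>u\<close> decreases while \<open>u n\<close> - 1/sqrt n increases,
  so their common limit (zeta(1/2)) lies between them.\<close>

lemma sum_inverse_sqrt_asymptotic:
  obtains c where "\<And>n. n \<ge> 1 \<Longrightarrow> \<bar>(\<Sum>e=1..n. 1 / sqrt (real e)) - 2 * sqrt (real n) - c\<bar> \<le> 1 / sqrt (real n)"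
proof -
  define u where "u n = (\<Sum>e=1..n. 1 / sqrt (real e)) - 2 * sqrt (real n)" for n
  have dec: "u (Suc n) \<le> u n" and inc: "u n - 1 / sqrt (real n) \<le> u (Suc n) - 1 / sqrt (real (Suc n))"
    if "n \<ge> 1" for n
    using sqrt_Suc_diff_bounds[OF that] by (auto simp: u_def)
  define X where "X n = u (Suc n)" for n
  have X: "decseq X" by (rule decseq_SucI) (simp add: X_def dec)
  have inc': "X n - 1 / sqrt (real (Suc n)) \<le> X k" if "n \<le> k" for n k
  proof -
    have "X n - 1 / sqrt (real (Suc n)) \<le> X k - 1 / sqrt (real (Suc k))"
      using that
    proof (induction k rule: dec_induct)
      case (step k)
      then show ?case using inc[of "Suc k"] unfolding X_def by linarith
    qed simp
    then show ?thesis by (smt (verit) divide_nonneg_nonneg real_sqrt_ge_zero of_nat_0_le_iff)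
  qed
  have "X 0 - 1 \<le> X k" for k using inc'[of 0 k] by simp
  then obtain c where c: "X \<longlonglongrightarrow> c" "\<And>i. c \<le> X i"
    using decseq_convergent[OF X] by blast
  have "\<bar>(\<Sum>e=1..n. 1 / sqrt (real e)) - 2 * sqrt (real n) - c\<bar> \<le> 1 / sqrt (real n)" if n: "n \<ge> 1" for n
  proof -
    obtain k where k: "n = Suc k" using n by (cases n) auto
    have "X k - 1 / sqrt (real (Suc k)) \<le> c"
      using inc' by (intro LIMSEQ_le_const[OF c(1)]) auto
    then show ?thesis using c(2)[of k] by (simp add: X_def u_def k)
  qed
  then show ?thesis using that by blast
qed

lemma sum_inverse_sqrt_le: "(\<Sum>e=1..n. 1 / sqrt (real e)) \<le> 2 * sqrt (real n)"
proof (induction n)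
  case (Suc n)
  show ?case
  proof (cases "n = 0")
    case False
    then show ?thesis using Suc sqrt_Suc_diff_bounds(1)[of n] by simp
  qed auto
qed auto

lemma ln_le_harmonic: "ln (real (Suc n)) \<le> (\<Sum>k=1..n. 1 / real k)"
proof (induction n)
  case (Suc n)
  have "ln (real (Suc (Suc n))) - ln (real (Suc n)) = ln (1 + 1 / real (Suc n))"
  proof -
    have "1 + 1 / real (Suc n) = real (Suc (Suc n)) / real (Suc n)" by (simp add: field_simps)
    then show ?thesis by (simp add: ln_div del: of_nat_Suc)
  qed
  also have "\<dots> \<le> 1 / real (Suc n)" by (intro ln_add_one_self_le_self) auto
  finally show ?case using Suc by simp
qed auto

text \<open>
  The divisor sums r of the character are nonnegative and at least 1 at squares, so the sum of
  r n / sqrt n over n <= M^2 exceeds ln M; if the harmonic value vanished, the hyperbola method would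
  bound it.
\<close>

lemma real_character_harmonic_value_nonzero:
  assumes m: "m > 0" and mz: "mean_zero m \<chi>"
    and mult: "\<And>a b. \<chi> (a * b) = \<chi> a * \<chi> b" and vals: "\<And>n. \<chi> n \<in> {-1, 0, 1}" and one: "\<chi> 1 = 1"
  shows "harmonic_value \<chi> \<noteq> 0"
proof
  assume zero: "harmonic_value \<chi> = 0"
  have B: "\<bar>\<chi> n\<bar> \<le> 1" for n using vals[of n] by auto
  obtain c where c: "\<And>n. n \<ge> 1 \<Longrightarrow>
      \<bar>(\<Sum>e=1..n. 1 / sqrt (real e)) - 2 * sqrt (real n) - c\<bar> \<le> 1 / sqrt (real n)"
    using sum_inverse_sqrt_asymptotic by blast
  define r where "r n = (\<Sum>d | d dvd n. \<chi> d)" for n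
  \<comment> \<open>The summands are, in order: the main term, the constant \<open>c\<close> and the
    error \<open>\<epsilon>\<close> for d <= M, then the range d > M.\<close>
  define K where "K = 2 * real m + \<bar>c\<bar> * real m + 3 + 2 * real m"
  have bound: "ln (real (Suc M)) \<le> K" if M: "M \<ge> 1" for M
  proof -
    define N where "N = M\<^sup>2"
    define H where "H n = (\<Sum>e=1..n. 1 / sqrt (real e))" for n
    have sqrtN: "sqrt (real N) = real M" by (simp add: N_def)
    have MN: "M \<le> N" using M by (simp add: N_def power2_eq_square)
    have "ln (real (Suc M)) \<le> (\<Sum>k=1..M. 1 / real k)" by (rule ln_le_harmonic)
    also have "\<dots> \<le> (\<Sum>k=1..M. r (k\<^sup>2) / sqrt (real (k\<^sup>2)))"
      using divisor_sum_square_ge_1[OF mult vals one] by (intro sum_mono) (auto simp: r_def divide_right_mono)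
    also have "\<dots> = (\<Sum>n\<in>(\<lambda>k. k\<^sup>2) ` {1..M}. r n / sqrt (real n))"
      by (subst sum.reindex) (auto simp: inj_on_def)
    also have "\<dots> \<le> (\<Sum>n=1..N. r n / sqrt (real n))"
      using divisor_sum_nonneg[OF mult vals one]
      by (intro sum_mono2) (auto simp: r_def N_def Suc_le_eq intro!: divide_nonneg_nonneg power_mono)
    also have "\<dots> = (\<Sum>n=1..N. \<Sum>d | d dvd n. \<chi> d / sqrt (real d) * (1 / sqrt (real (n div d))))"
    proof (rule sum.cong[OF refl])
      fix n assume "n \<in> {1..N}"
      have eq: "\<chi> d / sqrt (real n) = \<chi> d / sqrt (real d) * (1 / sqrt (real (n div d)))" if "d dvd n" for d
      proof -
        have "sqrt (real d) * sqrt (real (n div d)) = sqrt (real n)"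
          using that unfolding real_sqrt_mult[symmetric] of_nat_mult[symmetric] by simp
        then show ?thesis by simp
      qed
      then show "r n / sqrt (real n) = (\<Sum>d | d dvd n. \<chi> d / sqrt (real d) * (1 / sqrt (real (n div d))))"
        unfolding r_def sum_divide_distrib by (intro sum.cong refl) (simp only: mem_Collect_eq eq)
    qed
    also have "\<dots> = (\<Sum>d=1..N. \<Sum>e=1..N div d. \<chi> d / sqrt (real d) * (1 / sqrt (real e)))"
      by (rule sum_divisors_swap)
    \<comment> \<open>Hyperbola split at M = sqrt N: for d <= M the inner sum over e has its
      asymptotic expansion; for d > M the sums are exchanged, so that cancellation in
      \<open>\<chi>\<close> acts on the sum over d.\<close>
    also have "\<dots> = (\<Sum>d=1..M. \<Sum>e=1..N div d. \<chi> d / sqrt (real d) * (1 / sqrt (real e)))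
        + (\<Sum>d\<in>{M<..N}. \<Sum>e=1..N div d. \<chi> d / sqrt (real d) * (1 / sqrt (real e)))"
    proof -
      have "{1..N} = {1..M} \<union> {M<..N}" using MN by auto
      then show ?thesis by (simp only:) (rule sum.union_disjoint, auto)
    qed
    also have "(\<Sum>d=1..M. \<Sum>e=1..N div d. \<chi> d / sqrt (real d) * (1 / sqrt (real e)))
        \<le> 2 * real m + \<bar>c\<bar> * real m + 3"
    proof -
      define \<epsilon> where "\<epsilon> d = H (N div d) - 2 * (real M / sqrt (real d)) - c" for d
      have \<epsilon>: "\<bar>\<epsilon> d / sqrt (real d)\<bar> \<le> 3 / real M" if d: "d \<in> {1..M}" for d
      proof -
        define y where "y = N div d"
        have "d \<le> N" using d MN by auto
        then have y: "y \<ge> 1" using d by (simp add: y_def Suc_le_eq div_greater_zero_iff)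
        have "y * d \<le> N" "N < Suc y * d"
          using d by (auto simp: y_def mult.commute dividend_less_times_div)
        then have yN: "real y * real d \<le> real N" "real N \<le> (real y + 1) * real d"
          by (metis of_nat_le_iff of_nat_mult, metis less_imp_le of_nat_Suc of_nat_le_iff of_nat_mult add.commute)
        \<comment> \<open>\<open>t\<close> is the square root of N/d and \<open>s\<close> that of
          its floor; their squares differ by at most 1, so t - s <= 1/(2s).\<close>
        define s t where "s = sqrt (real y)" and "t = real M / sqrt (real d)"
        have s: "s \<ge> 1" "s\<^sup>2 = real y" using y by (auto simp: s_def)
        have t: "t > 0" "t\<^sup>2 = real N / real d" using d M by (auto simp: t_def N_def power_divide)
        have t2: "s\<^sup>2 \<le> t\<^sup>2" "t\<^sup>2 \<le> s\<^sup>2 + 1"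
          using yN d unfolding t(2) s(2) by (auto simp: field_simps)
        have st: "s \<le> t" using t2(1) t(1) by (meson less_imp_le power2_le_imp_le)
        have "(t - s) * (2 * s) \<le> (t - s) * (t + s)" using st s by (intro mult_left_mono) auto
        also have "\<dots> \<le> 1" using t2 by (simp add: algebra_simps power2_eq_square)
        finally have ts: "2 * (t - s) \<le> 1 / s" using s by (simp add: field_simps)
        have Hs: "\<bar>H y - 2 * s - c\<bar> \<le> 1 / s" using c[OF y] by (simp add: H_def s_def)
        have "\<bar>H y - 2 * t - c\<bar> \<le> 2 * k"
          if "\<bar>H y - 2 * s - c\<bar> \<le> k" "2 * (t - s) \<le> k" for k
          using that st by (simp add: abs_le_iff)
        from this[OF Hs ts] have "\<bar>H y - 2 * t - c\<bar> \<le> 2 * (1 / s)" .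
        also have "\<dots> \<le> 3 / t"
        proof -
          have "t\<^sup>2 \<le> 2 * s\<^sup>2" using t2 s by (smt (verit) one_le_power)
          then have "4 * t\<^sup>2 \<le> 9 * s\<^sup>2" using zero_le_power2[of s] by linarith
          then have "(2 * t)\<^sup>2 \<le> (3 * s)\<^sup>2" by (simp add: power_mult_distrib)
          then have "2 * t \<le> 3 * s" using s by (intro power2_le_imp_le[of "2 * t" "3 * s"]) auto
          then show ?thesis using s t by (simp add: field_simps)
        qed
        finally have "\<bar>\<epsilon> d\<bar> \<le> 3 / t" by (simp add: \<epsilon>_def y_def t_def)
        then have "\<bar>\<epsilon> d\<bar> / sqrt (real d) \<le> 3 / t / sqrt (real d)" by (intro divide_right_mono) auto
        also have "\<dots> = 3 / real M" using d by (simp add: t_def)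
        finally show ?thesis by simp
      qed
      have "(\<Sum>d=1..M. \<Sum>e=1..N div d. \<chi> d / sqrt (real d) * (1 / sqrt (real e)))
          = (\<Sum>d=1..M. \<chi> d / sqrt (real d) * H (N div d))"
        by (simp add: H_def sum_distrib_left)
      also have "\<dots> = (\<Sum>d=1..M. 2 * real M * (\<chi> d / real d) + c * (\<chi> d * (1 / sqrt (real d))) 
            + \<chi> d * (\<epsilon> d / sqrt (real d)))"
      proof (rule sum.cong[OF refl])
        fix d assume "d \<in> {1..M}"
        then have "real d = sqrt (real d) * sqrt (real d)" "sqrt (real d) > 0" by auto
        then show "\<chi> d / sqrt (real d) * H (N div d)
            = 2 * real M * (\<chi> d / real d) + c * (\<chi> d * (1 / sqrt (real d))) + \<chi> d * (\<epsilon> d / sqrt (real d))"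
          unfolding \<epsilon>_def by (simp add: field_simps)
      qed
      also have "\<dots> = 2 * real M * (\<Sum>d=1..M. \<chi> d / real d) + c * (\<Sum>d=1..M. \<chi> d * (1 / sqrt (real d)))
            + (\<Sum>d=1..M. \<chi> d * (\<epsilon> d / sqrt (real d)))"
        by (simp only: sum.distrib sum_distrib_left)
      \<comment> \<open>The vanishing harmonic value enters here: the partial sum is a mere tail of
        size O(1/M), which cancels the factor M.\<close>
      also have "2 * real M * (\<Sum>d=1..M. \<chi> d / real d) \<le> 2 * real m"
      proof -
        have "\<bar>\<Sum>d=1..M. \<chi> d / real d\<bar> \<le> real m / real (Suc M)"
          using mean_zero_harmonic_tail[OF m mz B, of M] zero by simp
        then have "2 * real M * (\<Sum>d=1..M. \<chi> d / real d) \<le> 2 * real M * (real m / real (Suc M))"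
          by (intro mult_left_mono) auto
        also have "\<dots> = 2 * real m * (real M / real (Suc M))" by simp
        also have "\<dots> \<le> 2 * real m * 1" by (intro mult_left_mono) auto
        finally show ?thesis by simp
      qed
      also have "c * (\<Sum>d=1..M. \<chi> d * (1 / sqrt (real d))) \<le> \<bar>c\<bar> * real m"
      proof -
        have "\<bar>\<Sum>d=1..<Suc M. \<chi> d * (1 / sqrt (real d))\<bar> \<le> real m * 1 * (1 / sqrt (real 1))"
          by (intro mean_zero_abel m mz B) (auto simp: frac_le)
        then have "\<bar>c * (\<Sum>d=1..M. \<chi> d * (1 / sqrt (real d)))\<bar> \<le> \<bar>c\<bar> * real m"
          by (auto simp: abs_mult atLeastLessThanSuc_atLeastAtMost intro!: mult_left_mono)
        then show ?thesis by linarith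
      qed
      also have "(\<Sum>d=1..M. \<chi> d * (\<epsilon> d / sqrt (real d))) \<le> (\<Sum>d=1..M. 3 / real M)"
      proof (rule sum_mono)
        fix d assume "d \<in> {1..M}"
        then have "\<bar>\<chi> d\<bar> * \<bar>\<epsilon> d / sqrt (real d)\<bar> \<le> 1 * (3 / real M)"
          using B \<epsilon> by (intro mult_mono) auto
        then have "\<bar>\<chi> d * (\<epsilon> d / sqrt (real d))\<bar> \<le> 3 / real M" by (simp only: abs_mult mult_1)
        then show "\<chi> d * (\<epsilon> d / sqrt (real d)) \<le> 3 / real M" by (rule order_trans[OF abs_ge_self])
      qed
      also have "(\<Sum>d=1..M. 3 / real M) = 3" using M by simp
      finally show ?thesis by simp
    qed
    also have "(\<Sum>d\<in>{M<..N}. \<Sum>e=1..N div d. \<chi> d / sqrt (real d) * (1 / sqrt (real e))) \<le> 2 * real m"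
    proof -
      have 1: "{1..N div d} = {e \<in> {1..M}. d * e \<le> N}" if "d \<in> {M<..N}" for d
      proof -
        have "e \<le> M" if "d * e \<le> N" for e
        proof (rule ccontr)
          assume "\<not> e \<le> M"
          then have "M * M < d * e" using \<open>d \<in> _\<close> by (intro mult_strict_mono) auto
          then show False using that by (simp add: N_def power2_eq_square)
        qed
        then show ?thesis using that by (auto simp: less_eq_div_iff_mult_less_eq mult.commute)
      qed
      have 2: "{d. d \<in> {M<..N} \<and> d * e \<le> N} = {Suc M..<Suc (N div e)}" if "e \<in> {1..M}" for e
        using that order_trans[of _ "_ * e" N]
        by (auto simp: less_eq_div_iff_mult_less_eq less_Suc_eq_le)
           (metis div_le_dividend le_trans less_eq_div_iff_mult_less_eq Suc_le_eq)
      have "(\<Sum>d\<in>{M<..N}. \<Sum>e=1..N div d. \<chi> d / sqrt (real d) * (1 / sqrt (real e)))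
          = (\<Sum>d\<in>{M<..N}. \<Sum>e | e \<in> {1..M} \<and> d * e \<le> N. \<chi> d / sqrt (real d) * (1 / sqrt (real e)))"
        by (intro sum.cong refl) (simp_all only: 1)
      also have "\<dots> = (\<Sum>e=1..M. \<Sum>d | d \<in> {M<..N} \<and> d * e \<le> N. \<chi> d / sqrt (real d) * (1 / sqrt (real e)))"
        by (rule sum.swap_restrict) auto
      also have "\<dots> = (\<Sum>e=1..M. (\<Sum>d=Suc M..<Suc (N div e). \<chi> d * (1 / sqrt (real d))) * (1 / sqrt (real e)))"
        by (intro sum.cong refl) (simp only: 2 sum_distrib_right, simp)
      also have "\<dots> \<le> (\<Sum>e=1..M. (real m * 1 * (1 / sqrt (real (Suc M)))) * (1 / sqrt (real e)))"
      proof (intro sum_mono mult_right_mono)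
        fix e
        have "\<bar>\<Sum>d=Suc M..<Suc (N div e). \<chi> d * (1 / sqrt (real d))\<bar> \<le> real m * 1 * (1 / sqrt (real (Suc M)))"
          by (intro mean_zero_abel m mz B) (auto simp: frac_le)
        then show "(\<Sum>d=Suc M..<Suc (N div e). \<chi> d * (1 / sqrt (real d))) \<le> real m * 1 * (1 / sqrt (real (Suc M)))"
          by linarith
      qed auto
      also have "\<dots> = real m / sqrt (real (Suc M)) * H M" by (simp add: H_def sum_distrib_left)
      also have "\<dots> \<le> real m / sqrt (real (Suc M)) * (2 * sqrt (real (Suc M)))"
        using sum_inverse_sqrt_le[of M] unfolding H_def
        by (intro mult_left_mono) (auto intro: order_trans)
      also have "\<dots> = 2 * real m" by simp
      finally show ?thesis .
    qed
    finally show ?thesis by (simp add: K_def)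
  qed
  obtain M :: nat where M: "real M > exp K" using reals_Archimedean2 by blast
  moreover have "exp K > 0" by simp
  ultimately have "real M > 0" by linarith
  then have "M \<ge> 1" by simp
  have "K = ln (exp K)" by simp
  also have "\<dots> < ln (real (Suc M))" using M by (subst ln_less_cancel_iff) auto
  also have "\<dots> \<le> K" by (rule bound) fact
  finally show False by simp
qed

section \<open>Primes in arithmetic progressions\<close>

lemma common_convergent_subseq:
  fixes X :: "'a \<Rightarrow> nat \<Rightarrow> real"
  assumes "finite A" "\<And>a. a \<in> A \<Longrightarrow> Bseq (X a)"
  shows "\<exists>r. strict_mono r \<and> (\<forall>a\<in>A. convergent (X a \<circ> r))"
  using assms
proof (induction A rule: finite_induct)
  case empty
  show ?case by (auto intro: strict_mono_id[unfolded id_def])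
next
  case (insert a A)
  then obtain r where r: "strict_mono r" "\<forall>a\<in>A. convergent (X a \<circ> r)" by blast
  obtain s where s: "strict_mono s" "monoseq (\<lambda>n. (X a \<circ> r) (s n))"
    using seq_monosub by blast
  have "Bseq (\<lambda>n. (X a \<circ> r) (s n))"
    using insert.prems[of a] Bseq_subseq[of "X a" "r \<circ> s"] by (simp add: o_def)
  then have "convergent (X a \<circ> (r \<circ> s))"
    using s Bseq_monoseq_convergent by (simp add: o_def)
  moreover have "convergent (X b \<circ> (r \<circ> s))" if "b \<in> A" for b
    using r that convergent_subseq_convergent[of "X b \<circ> r" s] s by (auto simp: o_assoc)
  ultimately show ?case using strict_mono_o[OF r(1) s(1)] by (intro exI[of _ "r \<circ> s"]) blast
qed

theorem dirichlet_primes_in_arithmetic_progressions: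
  fixes a m :: nat
  assumes "m > 0" "coprime a m"
  shows "infinite {p. prime p \<and> [p = a] (mod m)}"
proof
  assume fin: "finite {p. prime p \<and> [p = a] (mod m)}"
  define w where "w b N = (\<Sum>n | n \<in> {1..N} \<and> n mod m = b. mangoldt n / real n :: real)" for b N
  \<comment> \<open>The shift by 2 keeps the logarithm positive, so \<open>X\<close> is defined and
    bounded from index 0 on.\<close>
  define X where "X b N = w b (N + 2) / ln (real (N + 2))" for b N
  have w_nonneg: "w b N \<ge> 0" for b N
    unfolding w_def by (intro sum_nonneg) (simp add: mangoldt_nonneg)
  have w_upper: "w b N \<le> ln (real N) + 4" if "N > 0" for b N
  proof -
    have "w b N \<le> (\<Sum>n=1..N. mangoldt n / real n)"
      unfolding w_def by (intro sum_mono2) (auto simp: mangoldt_nonneg)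
    then show ?thesis using mertens_upper[OF that] by linarith
  qed
  have ln_pos: "ln (real (N + 2)) > 0" for N by simp
  have "Bseq (X b)" for b
  proof (rule BseqI')
    fix N
    have "\<bar>X b N\<bar> \<le> (ln (real (N + 2)) + 4) / ln (real (N + 2))"
      using w_upper[of "N + 2" b] w_nonneg[of b] ln_pos[of N] unfolding X_def
      by (simp add: divide_right_mono)
    also have "\<dots> = 1 + 4 / ln (real (N + 2))" using ln_pos[of N] by (simp add: add_divide_distrib)
    also have "\<dots> \<le> 1 + 4 / ln 2" by (intro add_left_mono divide_left_mono) auto
    finally show "norm (X b N) \<le> 1 + 4 / ln 2" by simp
  qed
  then obtain \<rho> where \<rho>: "strict_mono \<rho>" "\<forall>b\<in>{..<m}. convergent (X b \<circ> \<rho>)"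
    using common_convergent_subseq[of "{..<m}" X] by auto
  define W where "W b = lim (X b \<circ> \<rho>)" for b
  have W: "(\<lambda>j. X b (\<rho> j)) \<longlonglongrightarrow> W b" if "b < m" for b
    using \<rho> that by (auto simp: W_def convergent_LIMSEQ_iff o_def)
  have W_nonneg: "W b \<ge> 0" if "b < m" for b
    using w_nonneg ln_pos by (intro LIMSEQ_le_const[OF W[OF that]]) (auto simp: X_def less_imp_le)
  have "filterlim (\<lambda>j. real (\<rho> j + 2)) at_top sequentially"
    by (intro filterlim_compose[OF filterlim_real_sequentially] filterlim_compose[OF filterlim_add_const_nat_at_top] filterlim_subseq \<rho>)
  then have ln_lim: "filterlim (\<lambda>j. ln (real (\<rho> j + 2))) at_top sequentially"
    by (rule filterlim_compose[OF ln_at_top])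
  have small: "(\<lambda>j. g j / ln (real (\<rho> j + 2))) \<longlonglongrightarrow> 0" if "\<And>j. \<bar>g j\<bar> \<le> C" for g :: "nat \<Rightarrow> real" and C
  proof -
    have "(\<lambda>j. inverse (ln (real (\<rho> j + 2)))) \<longlonglongrightarrow> 0"
      by (rule tendsto_inverse_0_at_top[OF ln_lim])
    then have "Zfun (\<lambda>j. inverse (ln (real (\<rho> j + 2)))) sequentially" by (simp add: tendsto_Zfun_iff)
    moreover have "Bfun g sequentially" by (rule BfunI[of _ C]) (use that in auto)
    ultimately have "Zfun (\<lambda>j. inverse (ln (real (\<rho> j + 2))) * g j) sequentially"
      by (intro bounded_bilinear.Zfun_prod_Bfun[OF bounded_bilinear_mult])
    then show ?thesis by (simp add: tendsto_Zfun_iff divide_inverse mult.commute)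
  qed
  \<comment> \<open>Bridge from estimates to the limit: dividing by ln N removes the bounded error,
    so every Mertens-type estimate becomes an exact linear relation for \<open>W\<close>.\<close>
  have key: "(\<Sum>b<m. f b * W b) = - \<kappa>"
    if f: "residue_fun m f" and C: "\<And>N. N > 0 \<Longrightarrow> \<bar>(\<Sum>n=1..N. f n * mangoldt n / real n) + \<kappa> * ln (real N)\<bar> \<le> C"
    for f \<kappa> C
  proof -
    have sum_eq: "(\<Sum>n=1..N. f n * mangoldt n / real n) = (\<Sum>b<m. f b * w b N)" for N
    proof -
      have "(\<Sum>b<m. f b * w b N) = (\<Sum>b<m. \<Sum>n | n \<in> {1..N} \<and> n mod m = b. f n * mangoldt n / real n)"
        unfolding w_def sum_distrib_left by (intro sum.cong refl) (auto simp: residue_fun_mod[OF f])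
      also have "\<dots> = (\<Sum>n=1..N. f n * mangoldt n / real n)"
        by (rule sum.group) (use assms in auto)
      finally show ?thesis by simp
    qed
    have "(\<lambda>j. (\<Sum>b<m. f b * X b (\<rho> j)) + \<kappa>) \<longlonglongrightarrow> (\<Sum>b<m. f b * W b) + \<kappa>"
      by (intro tendsto_intros W) auto
    moreover have "(\<Sum>b<m. f b * X b (\<rho> j)) + \<kappa>
        = ((\<Sum>b<m. f b * w b (\<rho> j + 2)) + \<kappa> * ln (real (\<rho> j + 2))) / ln (real (\<rho> j + 2))" for j
      using ln_pos[of "\<rho> j"] by (simp add: X_def add_divide_distrib sum_divide_distrib)
    moreover have "(\<lambda>j. ((\<Sum>b<m. f b * w b (\<rho> j + 2)) + \<kappa> * ln (real (\<rho> j + 2))) / ln (real (\<rho> j + 2))) \<longlonglongrightarrow> 0"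
      by (rule small[of _ C], rule C[unfolded sum_eq], simp)
    ultimately have "(\<Sum>b<m. f b * W b) + \<kappa> = 0" using LIMSEQ_unique by simp
    then show ?thesis by simp
  qed
  \<comment> \<open>\<open>U\<close> is the principal character; \<open>\<delta>\<close>, the
    indicator of the class of 1, is the identity for convolution.\<close>
  define U :: "nat \<Rightarrow> real" where "U n = (if coprime n m then 1 else 0)" for n
  define \<delta> :: "nat \<Rightarrow> real" where "\<delta> n = (if [n = 1] (mod m) then 1 else 0)" for n
  define \<phi> where "\<phi> = (\<Sum>b<m. U b)"
  have U: "residue_fun m U"
    using assms(1) by (simp add: residue_fun_def U_def coprime_mod_left_iff)
  have U_mult: "U (x * y) = U x * U y" for x y by (simp add: U_def)
  have \<delta>: "residue_fun m \<delta>"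
  proof -
    have "coprime n m" if "[n = 1] (mod m)" for n
      using cong_imp_coprime[of 1 n m] that by (simp add: cong_sym)
    then show ?thesis by (auto simp: residue_fun_def \<delta>_def cong_def)
  qed
  have sum_\<delta>: "(\<Sum>b<m. \<delta> b) = 1"
  proof -
    have "(\<Sum>b<m. \<delta> b) = (\<Sum>b<m. if b = 1 mod m then 1 else 0)"
      by (intro sum.cong) (auto simp: \<delta>_def cong_def)
    then show ?thesis using assms by simp
  qed
  have inverse_ex: "\<exists>b<m. [g * b = 1] (mod m) \<and> coprime b m" if "coprime g m" for g
  proof -
    have "1 mod m \<in> (\<lambda>b. g * b mod m) ` {..<m}"
      using bij_betw_mult_mod[OF assms(1) that] assms(1) by (simp add: bij_betw_def)
    then obtain b where b: "b < m" "[g * b = 1] (mod m)" by (auto simp: cong_def)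
    then have "coprime (g * b) m" using cong_imp_coprime[of 1 "g * b" m] by (simp add: cong_sym)
    then show ?thesis using b by auto
  qed
  have \<phi>: "\<phi> > 0"
  proof -
    have "coprime (1 mod m) m" using assms(1) by (subst coprime_mod_left_iff) auto
    then have "U (1 mod m) = 1" by (simp only: U_def if_True)
    moreover have "\<phi> \<ge> U (1 mod m)"
      unfolding \<phi>_def by (rule member_le_sum) (use assms in \<open>auto simp: U_def\<close>)
    ultimately show ?thesis by linarith
  qed
  obtain C0 where C0: "\<And>N. N > 0 \<Longrightarrow>
      \<bar>(\<Sum>n | n \<in> {1..N} \<and> coprime n m. mangoldt n / real n) - ln (real N)\<bar> \<le> C0"
    using sum_mangoldt_coprime[OF assms(1)] by blast
  have W_total: "(\<Sum>b<m. U b * W b) = 1"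
  proof -
    have "(\<Sum>n=1..N. U n * mangoldt n / real n) = (\<Sum>n | n \<in> {1..N} \<and> coprime n m. mangoldt n / real n)" for N
      by (rule sum.mono_neutral_cong_right) (auto simp: U_def)
    then have "(\<Sum>b<m. U b * W b) = - (- 1)"
      by (intro key[OF U, where C = C0]) (use C0 in auto)
    then show ?thesis by simp
  qed
  text \<open>W is a probability measure on the units modulo m, and V is its reflection under inversion.\<close>
  define V where "V g = (\<Sum>b<m. W b * \<delta> (g * b))" for g
  have V_res: "residue_fun m V"
    unfolding residue_fun_def
  proof (intro conjI allI impI)
    show "V (g mod m) = V g" for g
      unfolding V_def by (intro sum.cong refl arg_cong2[of _ _ _ _ "(*)"] residue_fun_cong[OF \<delta>]) (simp add: mod_mult_left_eq)
    show "V g = 0" if "\<not> coprime g m" for g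
      unfolding V_def using that residue_fun_noncoprime[OF \<delta>] by (intro sum.neutral) auto
  qed
  have V_nonneg: "V g \<ge> 0" for g
    unfolding V_def by (intro sum_nonneg) (auto simp: \<delta>_def W_nonneg)
  have V_inverse: "V g = W b" if "b < m" "[g * b = 1] (mod m)" for g b
  proof -
    have "coprime (g * b) m" using that cong_imp_coprime[of 1 "g * b" m] by (simp add: cong_sym)
    then have g: "coprime g m" by simp
    have "[g * c = 1] (mod m) \<longleftrightarrow> c = b" if "c < m" for c
    proof
      assume "[g * c = 1] (mod m)"
      then have "[g * c = g * b] (mod m)" using \<open>[g * b = 1] (mod m)\<close> by (metis cong_sym cong_trans)
      then have "[c = b] (mod m)" using cong_mult_lcancel_nat[of g m c b] g by simp
      then show "c = b" using \<open>c < m\<close> \<open>b < m\<close> by (simp add: cong_def)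
    qed (use \<open>[g * b = 1] (mod m)\<close> in auto)
    then have "V g = (\<Sum>c<m. if c = b then W c else 0)"
      unfolding V_def by (intro sum.cong) (auto simp: \<delta>_def)
    then show ?thesis using \<open>b < m\<close> by simp
  qed
  have V_total: "(\<Sum>g<m. V g) = 1"
  proof -
    have "(\<Sum>g<m. V g) = (\<Sum>b<m. W b * (\<Sum>g<m. \<delta> (b * g)))"
      unfolding V_def by (subst sum.swap) (simp add: sum_distrib_left mult.commute)
    also have "\<dots> = (\<Sum>b<m. U b * W b)"
    proof (intro sum.cong refl)
      fix b
      have "(\<Sum>g<m. \<delta> (b * g)) = U b"
      proof (cases "coprime b m")
        case True
        then show ?thesis using sum_residue_fun_shift[OF assms(1) \<delta>] sum_\<delta> by (simp add: U_def)
      next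
        case False
        then show ?thesis using residue_fun_noncoprime[OF \<delta>, of "b * _"] by (simp add: U_def)
      qed
      then show "W b * (\<Sum>g<m. \<delta> (b * g)) = U b * W b" by simp
    qed
    finally show ?thesis using W_total by simp
  qed
  \<comment> \<open>The mean-zero part of the convolution identity. Averaging its shifts against
    \<open>W\<close> yields \<open>F\<close>, the mean-zero part of \<open>V\<close>.\<close>
  define f where "f n = \<delta> n - U n / \<phi>" for n
  have f: "mean_zero m f"
  proof -
    have "residue_fun m f" using \<delta> U by (auto simp: f_def residue_fun_def)
    moreover have "(\<Sum>b<m. f b) = 0"
      using sum_\<delta> \<phi> by (simp add: f_def sum_subtractf \<phi>_def flip: sum_divide_distrib)
    ultimately show ?thesis by (simp add: mean_zero_def)
  qed
  define F where "F n = V n - U n / \<phi>" for n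
  have F: "mean_zero m F"
  proof -
    have "residue_fun m F" using V_res U by (auto simp: F_def residue_fun_def)
    moreover have "(\<Sum>b<m. F b) = 0"
      using V_total \<phi> by (simp add: F_def sum_subtractf \<phi>_def flip: sum_divide_distrib)
    ultimately show ?thesis by (simp add: mean_zero_def)
  qed
  have F_eq: "F g = (\<Sum>b<m. W b * f (g * b))" for g
  proof -
    have "(\<Sum>b<m. W b * f (g * b)) = V g - (\<Sum>b<m. U b * W b) * (U g / \<phi>)"
      unfolding V_def sum_distrib_right sum_subtractf[symmetric]
      by (intro sum.cong) (auto simp: f_def U_mult algebra_simps)
    then show ?thesis using W_total by (simp add: F_def)
  qed
  \<comment> \<open>This harmonic value is the \<open>W\<close>-average of harmonic values of shifts
    of \<open>f\<close>, which the first Mertens-type estimate makes 0.\<close>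
  have F_harmonic: "harmonic_value (\<lambda>n. F (g * n)) = 0" for g
  proof -
    define h where "h x = harmonic_value (\<lambda>n. f (g * x * n))" for x
    have mz: "mean_zero m (\<lambda>n. f (g * n))" by (rule mean_zero_shift[OF assms(1) f])
    have "(\<lambda>n. \<Sum>b<m. W b * (f (g * b * Suc n) / real (Suc n))) sums (\<Sum>b<m. W b * h b)"
      unfolding h_def by (intro sums_sum sums_mult mean_zero_harmonic_sums[OF assms(1)] mean_zero_shift[OF assms(1) f])
    moreover have "(\<Sum>b<m. W b * (f (g * b * Suc n) / real (Suc n))) = F (g * Suc n) / real (Suc n)" for n
      unfolding F_eq sum_divide_distrib by (intro sum.cong refl) (simp add: mult_ac)
    ultimately have "(\<lambda>n. F (g * Suc n) / real (Suc n)) sums (\<Sum>b<m. W b * h b)" by simp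
    then have eq: "harmonic_value (\<lambda>n. F (g * n)) = (\<Sum>b<m. W b * h b)"
      unfolding harmonic_value_def by (simp add: sums_iff)
    obtain C where C: "\<And>N. N > 0 \<Longrightarrow> \<bar>\<Sum>d=1..N. mangoldt d / real d * harmonic_value (\<lambda>n. f (g * (d * n)))\<bar> \<le> C"
      using sum_mangoldt_harmonic_value_bounded[OF assms(1) mz] by metis
    have "residue_fun m h"
      unfolding residue_fun_def
    proof (intro conjI allI impI)
      show "h (x mod m) = h x" for x
        unfolding h_def using f 
        by (intro arg_cong[of _ _ harmonic_value] ext residue_fun_cong[of m f])
           (auto simp: mean_zero_def mod_mult_left_eq mod_mult_right_eq intro!: mod_mult_cong)
      show "h x = 0" if "\<not> coprime x m" for x
      proof -
        have "f (g * x * n) = 0" for n using f that by (intro residue_fun_noncoprime) (auto simp: mean_zero_def)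
        then show ?thesis by (simp add: h_def harmonic_value_def)
      qed
    qed
    then have "(\<Sum>b<m. h b * W b) = - 0"
    proof (rule key)
      fix N :: nat assume "N > 0"
      have "(\<Sum>d=1..N. h d * mangoldt d / real d)
          = (\<Sum>d=1..N. mangoldt d / real d * harmonic_value (\<lambda>n. f (g * (d * n))))"
        by (intro sum.cong refl) (simp add: h_def mult.assoc)
      then show "\<bar>(\<Sum>d=1..N. h d * mangoldt d / real d) + 0 * ln (real N)\<bar> \<le> C"
        using C[OF \<open>N > 0\<close>] by simp
    qed
    then show ?thesis unfolding eq by (simp add: mult.commute)
  qed
  \<comment> \<open>As all harmonic values of \<open>F\<close> vanish, the second estimate makes
    averaging against \<open>W\<close> act on \<open>F\<close> as -1; restoring the uniform part on
    both sides gives \<open>2 / \<phi>\<close>.\<close>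
  have V_conv: "(\<Sum>b<m. W b * V (g * b)) = 2 / \<phi> - V g" if g: "coprime g m" for g
  proof -
    have mz: "mean_zero m (\<lambda>n. F (g * n))" by (rule mean_zero_shift[OF assms(1) F])
    have "harmonic_value (\<lambda>n. F (g * (g' * n))) = 0" for g'
      using F_harmonic[of "g * g'"] by (simp add: mult.assoc)
    then obtain C where C: "\<And>N. N > 0 \<Longrightarrow> \<bar>(\<Sum>n=1..N. F (g * n) * mangoldt n / real n) + F (g * 1) * ln (real N)\<bar> \<le> C"
      using sum_mangoldt_of_harmonic_zero[OF assms(1) mz] by metis
    have "residue_fun m (\<lambda>n. F (g * n))" using mz by (simp add: mean_zero_def)
    from key[OF this C] have "(\<Sum>b<m. F (g * b) * W b) = - F g" by simp
    moreover have "(\<Sum>b<m. F (g * b) * W b) = (\<Sum>b<m. W b * V (g * b)) - (\<Sum>b<m. U b * W b) * (U g / \<phi>)"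
      unfolding sum_distrib_right sum_subtractf[symmetric]
      by (intro sum.cong) (auto simp: F_def U_mult algebra_simps)
    ultimately show ?thesis using W_total g by (simp add: F_def U_def)
  qed
  have V_upper: "V g \<le> 2 / \<phi> * U g" for g
  proof (cases "coprime g m")
    case True
    have "(\<Sum>b<m. W b * V (g * b)) \<ge> 0" using V_nonneg W_nonneg by (intro sum_nonneg) auto
    then show ?thesis using V_conv[OF True] True by (simp add: U_def)
  next
    case False
    then show ?thesis using residue_fun_noncoprime[OF V_res] by (simp add: U_def)
  qed
  define B where "B = {b. b < m \<and> coprime b m \<and> W b > 0}"
  \<comment> \<open>If \<open>V g = 0\<close>, the average of \<open>V (g * b)\<close> equals the
    upper bound \<open>2 / \<phi>\<close>, so the bound is attained at every \<open>b\<close> of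
    positive weight.\<close>
  have V_swap0: "V (g * b) = 2 / \<phi>" if g: "coprime g m" "V g = 0" and b: "b \<in> B" for g b
  proof -
    have "(\<Sum>b<m. W b * (2 / \<phi> * U (g * b) - V (g * b))) = 2 / \<phi> * (\<Sum>b<m. U b * W b) - (\<Sum>b<m. W b * V (g * b))"
      unfolding sum_distrib_left sum_subtractf[symmetric] using g
      by (intro sum.cong) (auto simp: algebra_simps U_mult, auto simp: U_def)
    also have "\<dots> = 0" using W_total V_conv[OF g(1)] g(2) by simp
    finally have "\<forall>b\<in>{..<m}. W b * (2 / \<phi> * U (g * b) - V (g * b)) = 0"
      using W_nonneg V_upper by (subst (asm) sum_nonneg_eq_0_iff) auto
    then show ?thesis using b g by (force simp: B_def U_def)
  qed
  have V_swap1: "V (g * b) = 0" if g: "coprime g m" "V g = 2 / \<phi>" and b: "b \<in> B" for g b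
  proof -
    have "(\<Sum>b<m. W b * V (g * b)) = 0" using V_conv[OF g(1)] g(2) by simp
    then have "\<forall>b\<in>{..<m}. W b * V (g * b) = 0"
      using W_nonneg V_nonneg by (subst (asm) sum_nonneg_eq_0_iff) auto
    then show ?thesis using b by (force simp: B_def)
  qed
  \<comment> \<open>The assumed finiteness is used here: the class of \<open>a\<close> then has
    bounded total weight, since its nonprime members contribute at most 8.\<close>
  have W_a: "W (a mod m) = 0"
  proof -
    define D where "D = (\<Sum>p | prime p \<and> [p = a] (mod m). mangoldt p / real p :: real)"
    have "\<bar>w (a mod m) N\<bar> \<le> D + 8" for N
    proof -
      let ?P = "{p. prime p \<and> [p = a] (mod m)}" and ?Q = "{n. n \<in> {1..N} \<and> \<not> prime n}"
      have "w (a mod m) N \<le> (\<Sum>n\<in>?P \<union> ?Q. mangoldt n / real n)"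
        unfolding w_def using fin by (intro sum_mono2) (auto simp: mangoldt_nonneg cong_def)
      also have "\<dots> = D + (\<Sum>n\<in>?Q. mangoldt n / real n)"
        unfolding D_def using fin by (intro sum.union_disjoint) auto
      also have "\<dots> \<le> D + 8" using sum_mangoldt_nonprime_le[of N] by simp
      finally show ?thesis using w_nonneg[of "a mod m" N] by simp
    qed
    then have "(\<lambda>j. X (a mod m) (\<rho> j)) \<longlonglongrightarrow> 0"
      unfolding X_def by (intro small[of _ "D + 8"]) auto
    then show ?thesis using W[of "a mod m"] assms LIMSEQ_unique by auto
  qed
  obtain g0 where g0: "coprime g0 m" "[g0 * (a mod m) = 1] (mod m)"
    using inverse_ex[OF assms(2)] by (auto simp: mult.commute cong_def mod_mult_right_eq)
  have V_g0: "V g0 = 0" using V_inverse[of "a mod m" g0] g0 W_a assms by simp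
  have V_two_values: "V g = 0 \<or> V g = 2 / \<phi>" if "coprime g m" for g
  proof -
    have Bm: "B \<subseteq> {..<m}" "finite B" by (auto simp: B_def)
    \<comment> \<open>On \<open>B\<close> the values \<open>V (g0 * b) = 2 / \<phi>\<close> dominate
      \<open>W b\<close>, so they already carry the total mass 1; \<open>V (g0 * b)\<close> must
      vanish off \<open>B\<close>. As b varies, g0 b meets every class.\<close>
    have "1 = (\<Sum>b<m. U b * W b)" using W_total by simp
    also have "\<dots> = (\<Sum>b\<in>B. W b)"
      using W_nonneg by (intro sum.mono_neutral_cong_right) (force simp: B_def U_def)+
    also have "\<dots> \<le> (\<Sum>b\<in>B. V (g0 * b))"
    proof (intro sum_mono)
      fix b assume b: "b \<in> B"
      then obtain c where "c < m" "[b * c = 1] (mod m)" "coprime c m"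
        using inverse_ex[of b] by (auto simp: B_def)
      then have "V c = W b" using V_inverse[of b c] b by (simp add: B_def mult.commute)
      then show "W b \<le> V (g0 * b)" 
        using V_upper[of c] \<open>coprime c m\<close> V_swap0[OF g0(1) V_g0 b] by (simp add: U_def)
    qed
    finally have 1: "1 \<le> (\<Sum>b\<in>B. V (g0 * b))" .
    have "1 = (\<Sum>b<m. V (g0 * b))"
      using sum_residue_fun_shift[OF assms(1) V_res g0(1)] V_total by simp
    also have "\<dots> = (\<Sum>b\<in>B. V (g0 * b)) + (\<Sum>b\<in>{..<m} - B. V (g0 * b))"
      using Bm by (simp add: sum.subset_diff[of B "{..<m}"] add.commute)
    finally have "(\<Sum>b\<in>{..<m} - B. V (g0 * b)) = 0"
      using 1 V_nonneg by (smt (verit) sum_nonneg)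
    then have out: "V (g0 * b) = 0" if "b < m" "b \<notin> B" for b
      using V_nonneg that by (subst (asm) sum_nonneg_eq_0_iff) auto
    have "g mod m \<in> (\<lambda>b. g0 * b mod m) ` {..<m}"
      using bij_betw_mult_mod[OF assms(1) g0(1)] assms(1) by (simp add: bij_betw_def)
    then obtain b where b: "b < m" "g mod m = g0 * b mod m" by auto
    then have "V g = V (g0 * b)" by (intro residue_fun_cong[OF V_res])
    then show ?thesis using out[OF b(1)] V_swap0[OF g0(1) V_g0] by (cases "b \<in> B") auto
  qed
  \<comment> \<open>Equal to \<open>- \<phi> * F\<close>; on units it is 1 where \<open>V\<close> is
    0 and -1 where \<open>V\<close> is \<open>2 / \<phi>\<close>. It is the real character to be
    excluded.\<close>
  define \<psi> where "\<psi> g = U g - \<phi> * V g" for g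
  have \<psi>: "mean_zero m \<psi>"
  proof -
    have "residue_fun m \<psi>" using V_res U by (auto simp: \<psi>_def residue_fun_def)
    moreover have "(\<Sum>b<m. \<psi> b) = 0"
      using V_total by (simp add: \<psi>_def sum_subtractf \<phi>_def flip: sum_distrib_left)
    ultimately show ?thesis by (simp add: mean_zero_def)
  qed
  have \<psi>_noncoprime: "\<psi> g = 0" if "\<not> coprime g m" for g
    using \<psi> that residue_fun_noncoprime[of m \<psi> g] by (simp add: mean_zero_def)
  have \<psi>_iff: "\<psi> g = 1 \<longleftrightarrow> V g = 0" "\<psi> g = -1 \<longleftrightarrow> V g = 2 / \<phi>" if "coprime g m" for g
    using that \<phi> by (auto simp: \<psi>_def U_def field_simps)
  have \<psi>_values: "\<psi> g = 1 \<or> \<psi> g = -1" if "coprime g m" for g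
    using V_two_values[OF that] \<psi>_iff[OF that] by auto
  have \<psi>_B: "\<psi> (g * b) = - \<psi> g" if "coprime g m" "b \<in> B" for g b
  proof -
    have "coprime (g * b) m" using that by (simp add: B_def)
    then show ?thesis
      using V_swap0[OF that(1) _ that(2)] V_swap1[OF that(1) _ that(2)] \<psi>_values[OF that(1)] \<psi>_iff \<phi> that(1)
      by (metis minus_minus)
  qed
  \<comment> \<open>The inverse b of such an s lies in \<open>B\<close>, so \<open>\<psi>_B\<close>,
    applied to the step from g s to g s b = g, gives the sign change.\<close>
  have \<psi>_minus: "\<psi> (g * s) = - \<psi> g" if g: "coprime g m" and s: "coprime s m" "\<psi> s = -1" for g s
  proof -
    obtain b where b: "b < m" "[s * b = 1] (mod m)" "coprime b m" using inverse_ex[OF s(1)] by blast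
    have "W b = 2 / \<phi>" using V_inverse[OF b(1,2)] s \<psi>_iff by simp
    then have "b \<in> B" using b \<phi> by (simp add: B_def)
    have "\<psi> g = \<psi> (g * s * b)"
    proof (rule residue_fun_cong[of m])
      have "[g * (s * b) = g * 1] (mod m)" using b(2) by (rule cong_scalar_left)
      then show "g mod m = g * s * b mod m" by (simp add: cong_def mult.assoc)
    qed (use \<psi> in \<open>simp add: mean_zero_def\<close>)
    also have "\<dots> = - \<psi> (g * s)" using \<psi>_B[of "g * s" b] g s \<open>b \<in> B\<close> by simp
    finally show ?thesis by simp
  qed
  obtain s where s: "coprime s m" "\<psi> s = -1"
  proof -
    have "\<exists>g<m. \<psi> g < 0"
    proof (rule ccontr)
      assume "\<not> ?thesis"
      then have "\<psi> g \<ge> 0" if "g < m" for g using that by force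
      moreover have "(\<Sum>g<m. \<psi> g) = 0" using \<psi> by (simp add: mean_zero_def)
      ultimately have "\<psi> (a mod m) = 0" using assms(1) by (subst (asm) sum_nonneg_eq_0_iff) auto
      then show False using \<psi>_values[of "a mod m"] assms coprime_mod_left_iff[of m a] by simp
    qed
    then obtain g where "\<psi> g < 0" by blast
    then have "coprime g m" using \<psi>_noncoprime by force
    then show ?thesis using \<psi>_values \<open>\<psi> g < 0\<close> that by force
  qed
  have mult: "\<psi> (x * y) = \<psi> x * \<psi> y" for x y
  proof (cases "coprime x m \<and> coprime y m")
    case True
    then consider "\<psi> y = -1" | "\<psi> y = 1" using \<psi>_values by blast
    then show ?thesis
    proof cases
      case 1
      then show ?thesis using \<psi>_minus True by simp
    next
      case 2
      \<comment> \<open>Multiplication by s moves y to the sign -1, where the rule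
        \<open>\<psi>_minus\<close> applies.\<close>
      have "\<psi> (y * s) = -1" using \<psi>_minus[of y s] True s 2 by simp
      then have "\<psi> (x * (y * s)) = - \<psi> x" using \<psi>_minus[of x "y * s"] True s by simp
      moreover have "\<psi> (x * y * s) = - \<psi> (x * y)" using \<psi>_minus[of "x * y" s] True s by simp
      ultimately show ?thesis using 2 by (simp add: mult.assoc)
    qed
  next
    case False
    then show ?thesis using \<psi>_noncoprime by auto
  qed
  have one: "\<psi> 1 = 1"
    using \<psi>_minus[of 1 s] s by simp
  have vals: "\<psi> n \<in> {-1, 0, 1}" for n
    using \<psi>_values[of n] \<psi>_noncoprime[of n] by auto
  have "(\<lambda>n. - \<phi> * (F (1 * Suc n) / real (Suc n))) sums (- \<phi> * harmonic_value (\<lambda>n. F (1 * n)))"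
    by (intro sums_mult mean_zero_harmonic_sums[OF assms(1)] mean_zero_shift[OF assms(1) F])
  moreover have "- \<phi> * (F (1 * Suc n) / real (Suc n)) = \<psi> (Suc n) / real (Suc n)" for n
  proof -
    have "- \<phi> * F k = \<psi> k" for k using \<phi> by (simp add: F_def \<psi>_def right_diff_distrib)
    then show ?thesis by (simp only: times_divide_eq_right mult_1)
  qed
  ultimately have "harmonic_value \<psi> = 0"
    unfolding harmonic_value_def[of \<psi>] using F_harmonic[of 1] by (simp add: sums_iff)
  then show False
    using real_character_harmonic_value_nonzero[OF assms(1) \<psi> mult vals one] by blast
qed

section \<open>Coefficients of ternary inclusion-exclusion polynomials\<close>

text \<open>\<open>L\<close> inverts both \<open>Q\<close> and \<open>K\<close> modulo
  \<open>P\<close>, and \<open>R\<close> inverts \<open>K\<close> modulo \<open>P * Q\<close>. The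
  bound on \<open>Q\<close> makes a window shorter than \<open>Q\<close>; the bound on
  \<open>R\<close> makes one step in the binary index outweigh the exponent offsets i < P and
  \<open>Q\<close>. Integers serve because windows may reach below 0.\<close>

locale ternary_parameters =
  fixes P Q R K L :: int
  assumes P: "P \<ge> 3" and L: "0 < L" "L < P" and K: "0 < K"
    and LQ: "(L * Q) mod P = 1" and LK: "(L * K) mod P = 1"
    and Q: "K * P + 2 \<le> Q" and KR: "(K * R) mod (P * Q) = 1" and R: "P + Q \<le> R"
begin

text \<open>
  For 0 <= j < P * Q, the semigroup generated by P and Q contains j iff Q * y j <= j, i.e. iff D j = 0.
  So a is the P * Q-periodic extension of the coefficient sequence of
  (1 - x) (1 - x^(P Q)) / ((1 - x^P) (1 - x^Q)).
\<close>

definition y :: "int \<Rightarrow> int" where "y j = (L * j) mod P"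
definition D :: "int \<Rightarrow> int" where "D j = (j - Q * y j) div (P * Q)"
definition a :: "int \<Rightarrow> int" where "a j = D j - D (j - 1)"

lemma Q_pos: "Q > 0" and KP_pos: "K * P > 0" and PQ_pos: "P * Q > 0" and R_pos: "R > 0"
  and K_le: "K \<le> K * P" and P_le: "P \<le> K * P"
proof -
  show 1: "K * P > 0" using K P by simp
  show 2: "Q > 0" using 1 Q by linarith
  show "P * Q > 0" using 2 P by simp
  show "R > 0" using R P 2 by linarith
  show "K \<le> K * P" "P \<le> K * P" using K P by (simp_all add: mult_le_cancel_left1 mult_le_cancel_right1)
qed

lemma y_bounds: "0 \<le> y j" "y j < P"
  using P by (simp_all add: y_def)

lemma Qy_le: "Q * y j \<le> P * Q - Q"
proof -
  have "Q * y j \<le> Q * (P - 1)" using y_bounds(2)[of j] Q_pos by (intro mult_left_mono) auto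
  then show ?thesis by (simp add: algebra_simps)
qed

lemma Qy_nonneg: "0 \<le> Q * y j"
  using y_bounds(1)[of j] Q_pos by simp

lemma D_eq:
  assumes "-Q \<le> j" "j < P * Q"
  shows "D j = (if Q * y j \<le> j then 0 else -1)"
proof (cases "Q * y j \<le> j")
  case True
  then have "D j = 0" unfolding D_def using Qy_nonneg[of j] assms by (intro div_pos_pos_trivial) auto
  then show ?thesis using True by simp
next
  case False
  have "D j = -1" unfolding D_def
    using False Qy_le[of j] assms by (intro int_div_pos_eq[where r = "j - Q * y j + P * Q"]) auto
  then show ?thesis using False by simp
qed

lemma y_period: "y (j + P * Q * t) = y j"
proof -
  have "L * (j + P * Q * t) = L * j + P * (L * Q * t)" by (simp add: algebra_simps)
  then show ?thesis by (simp add: y_def)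
qed

lemma D_period: "D (j + P * Q * t) = D j + t"
proof -
  have "j + P * Q * t - Q * y j = (j - Q * y j) + t * (P * Q)" by (simp add: algebra_simps)
  then show ?thesis unfolding D_def y_period using PQ_pos by (simp only: div_mult_self1)
qed

lemma a_period: "a (j + P * Q * t) = a j"
proof -
  have "j + P * Q * t - 1 = (j - 1) + P * Q * t" by simp
  then show ?thesis unfolding a_def by (simp only: D_period)
qed

lemma a_mod: "a (j mod (P * Q)) = a j"
  using a_period[of "j mod (P * Q)" "j div (P * Q)"] by (simp add: mult.commute)

lemma a_cong: "i mod (P * Q) = j mod (P * Q) \<Longrightarrow> a i = a j"
  using a_mod by metis

lemma y_eq_0_iff: "y j = 0 \<longleftrightarrow> P dvd j"
proof
  assume "y j = 0"
  then have "P dvd L * j" by (auto simp: y_def)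
  then have "P dvd K * (L * j)" by (rule dvd_mult)
  moreover have "K * (L * j) = (L * K) * j" by simp
  moreover have "((L * K) * j) mod P = j mod P"
    using LK by (metis mod_mult_left_eq mult_1)
  ultimately show "P dvd j" by (metis dvd_eq_mod_eq_0)
qed (simp add: y_def)

text \<open>Subtracting \<open>Q\<close> lowers the row by 1 and leaves \<open>j - Q * y j\<close>
  unchanged, except that row 0 wraps to P - 1 and changes it by P Q. Multiplying the semigroup
  series by 1 - x^Q thus leaves multiples of \<open>P\<close>.\<close>

lemma D_shift: "D j - D (j - Q) = (if P dvd j then 1 else 0)"
proof -
  have y': "y (j - Q) = (y j - 1) mod P"
  proof -
    have "y (j - Q) = (L * j - L * Q) mod P" by (simp add: y_def right_diff_distrib)
    also have "\<dots> = (y j - 1) mod P" unfolding y_def using LQ by (metis mod_diff_eq mod_mod_trivial)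
    finally show ?thesis .
  qed
  show ?thesis
  proof (cases "y j = 0")
    case True
    then have yv: "y (j - Q) = P - 1" using y' P by (simp add: zmod_minus1)
    have "j - Q - Q * (P - 1) = j - Q * y j + (-1) * (P * Q)" using True by (simp add: algebra_simps)
    then have "D (j - Q) = (j - Q * y j + (-1) * (P * Q)) div (P * Q)"
      unfolding D_def[of "j - Q"] yv by (simp only:)
    also have "\<dots> = D j - 1" unfolding D_def using PQ_pos by (subst div_mult_self1) auto
    finally show ?thesis using True y_eq_0_iff by simp
  next
    case False
    then have yv: "y (j - Q) = y j - 1" using y' y_bounds[of j] by (simp add: mod_pos_pos_trivial)
    have "j - Q - Q * (y j - 1) = j - Q * y j" by (simp add: algebra_simps)
    then have "D (j - Q) = D j" unfolding D_def yv by (simp only:)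
    then show ?thesis using False y_eq_0_iff by simp
  qed
qed

lemma y_step: "y (N - K * i) = (L * N - i) mod P"
proof -
  have "y (N - K * i) = (L * N - (L * K) * i) mod P" by (simp add: y_def algebra_simps)
  also have "\<dots> = (L * N - i) mod P" using LK by (metis mod_diff_right_eq mod_mult_left_eq mult_1)
  finally show ?thesis .
qed

lemma y_step_inj: "inj_on (\<lambda>i. y (N - K * i)) {0..<P}"
proof (rule inj_onI)
  fix i j assume ij: "i \<in> {0..<P}" "j \<in> {0..<P}" "y (N - K * i) = y (N - K * j)"
  then have "P dvd (L * N - i) - (L * N - j)" by (simp add: y_step mod_eq_dvd_iff)
  then have "P dvd j - i" by simp
  then show "i = j" using ij zdvd_imp_le[of P "j - i"] zdvd_imp_le[of P "i - j"]
    by (cases "i < j"; cases "j < i") (auto simp: dvd_diff_commute)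
qed

lemma sum_dvd_step: "(\<Sum>i\<in>{0..<P}. if P dvd N - K * i then 1 else 0 :: int) = 1"
proof -
  have "(\<lambda>i. y (N - K * i)) ` {0..<P} = {0..<P}"
  proof (rule endo_inj_surj[OF _ _ y_step_inj])
    show "(\<lambda>i. y (N - K * i)) ` {0..<P} \<subseteq> {0..<P}" using y_bounds by auto
  qed simp
  then have "bij_betw (\<lambda>i. y (N - K * i)) {0..<P} {0..<P}"
    using y_step_inj by (simp add: bij_betw_def)
  from sum.reindex_bij_betw[OF this, of "\<lambda>x. if x = 0 then 1 else 0 :: int"]
  have "(\<Sum>i\<in>{0..<P}. if y (N - K * i) = 0 then 1 else 0 :: int) = (\<Sum>x\<in>{0..<P}. if x = 0 then 1 else 0)" .
  then show ?thesis using P by (simp add: y_eq_0_iff)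
qed

text \<open>By \<open>D_shift\<close> a shift by \<open>Q\<close> changes each term by a difference
  of divisibility indicators, and every window contains exactly one multiple of
  \<open>P\<close>.\<close>

lemma window_sum_shift: "(\<Sum>i\<in>{0..<P}. a (N - Q * int t - K * i)) = (\<Sum>i\<in>{0..<P}. a (N - K * i))"
proof (induction t)
  case (Suc t)
  have step: "(\<Sum>i\<in>{0..<P}. a (M - K * i)) - (\<Sum>i\<in>{0..<P}. a (M - Q - K * i)) = 0" for M
  proof -
    have "a (M - K * i) - a (M - Q - K * i)
       = (if P dvd M - K * i then 1 else 0) - (if P dvd (M - 1) - K * i then 1 else 0)" for i
      using D_shift[of "M - K * i"] D_shift[of "M - 1 - K * i"] by (simp add: a_def algebra_simps)
    then show ?thesis by (simp add: sum_dvd_step flip: sum_subtractf) (simp add: sum_subtractf sum_dvd_step)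
  qed
  have "N - Q * int (Suc t) - K * i = (N - Q * int t) - Q - K * i" for i by (simp add: algebra_simps)
  then have "(\<Sum>i\<in>{0..<P}. a (N - Q * int (Suc t) - K * i)) = (\<Sum>i\<in>{0..<P}. a (N - Q * int t - Q - K * i))"
    by (simp only:)
  then show ?case using step[of "N - Q * int t"] Suc by linarith
qed simp

lemma window_sum_shift_K:
  "(\<Sum>i\<in>{0..<P}. a ((N - K * Q) mod (P * Q) - K * i)) = (\<Sum>i\<in>{0..<P}. a (N - K * i))"
proof -
  have "a ((N - K * Q) mod (P * Q) - K * i) = a (N - Q * int (nat K) - K * i)" for i
    by (rule a_cong) (use K in \<open>simp add: mod_diff_left_eq mult.commute\<close>)
  then show ?thesis by (simp only: window_sum_shift)
qed

lemma a_zero_negative: "-Q < j \<Longrightarrow> j < 0 \<Longrightarrow> a j = 0"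
  using D_eq[of j] D_eq[of "j - 1"] Qy_nonneg[of j] Qy_nonneg[of "j - 1"] PQ_pos by (auto simp: a_def)

lemma y_pred: "y (j - 1) = (if L \<le> y j then y j - L else y j - L + P)"
proof -
  have "y (j - 1) = (y j - L) mod P" by (simp add: y_def right_diff_distrib mod_diff_left_eq)
  moreover have "(y j - L) mod P = (if L \<le> y j then y j - L else y j - L + P)"
    using y_bounds[of j] L by (auto simp: mod_pos_pos_trivial intro!: int_mod_pos_eq[where q = "-1"])
  ultimately show ?thesis by simp
qed

text \<open>The rows of j and j - 1 differ by L modulo P. Without a wrap (row at least L) the
  threshold for j - 1 is lower, so \<open>D\<close> can only drop from j - 1 to j; with a wrap it is
  higher and \<open>D\<close> can only rise. Hence the row determines the sign.\<close>

lemma a_values: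
  assumes "-Q < j" "j < P * Q"
  shows "a j = (if L \<le> y j then (if Q * (y j - L) < j \<and> j < Q * y j then -1 else 0)
                else (if Q * y j \<le> j \<and> j \<le> Q * (y j - L + P) then 1 else 0))"
proof (cases "L \<le> y j")
  case True
  define z where "z = Q * L"
  have "Q * 1 \<le> z" unfolding z_def using L Q_pos by (intro mult_left_mono) auto
  moreover have "Q * (y j - L) = Q * y j - z" by (simp add: z_def right_diff_distrib)
  ultimately show ?thesis
    using True Q_pos D_eq[of j] D_eq[of "j - 1"] assms by (auto simp: a_def y_pred)
next
  case False
  define z where "z = Q * (P - L)"
  have "Q * 1 \<le> z" unfolding z_def using L Q_pos by (intro mult_left_mono) auto
  moreover have "Q * (y j - L + P) = Q * y j + z" by (simp add: z_def algebra_simps)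
  ultimately show ?thesis
    using False Q_pos D_eq[of j] D_eq[of "j - 1"] assms by (auto simp: a_def y_pred)
qed

section \<open>Partial sums over a window\<close>

lemma step_range:
  assumes "0 \<le> N" "N < P * Q" "0 \<le> i" "i < P"
  shows "N - Q < N - K * i" "-Q < N - K * i" "N - K * i < P * Q" "N - K * i \<le> N"
proof -
  have "K * i \<le> K * P" "0 \<le> K * i" using assms K by auto
  then show "N - Q < N - K * i" "-Q < N - K * i" "N - K * i < P * Q" "N - K * i \<le> N"
    using assms Q by linarith+
qed

lemma segment_upper:
  assumes N: "0 \<le> N" "N < P * Q" and "0 \<le> A" "B \<le> P"
  shows "(\<Sum>i\<in>{A..<B}. a (N - K * i)) \<le> L"
proof -
  let ?I = "{i \<in> {A..<B}. y (N - K * i) < L}"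
  have "(\<Sum>i\<in>{A..<B}. a (N - K * i)) \<le> (\<Sum>i\<in>{A..<B}. if y (N - K * i) < L then 1 else 0)"
    using assms a_values[OF step_range(2,3)[OF N]] by (intro sum_mono) auto
  also have "\<dots> = int (card ?I)" by (simp add: sum.If_cases Int_def)
  also have "card ?I \<le> card {0..<L}"
  proof (rule card_inj_on_le)
    show "inj_on (\<lambda>i. y (N - K * i)) ?I"
      by (rule inj_on_subset[OF y_step_inj]) (use assms in auto)
  qed (use y_bounds in auto)
  also have "int (card {0..<L}) = L" using L by simp
  finally show ?thesis by simp
qed

text \<open>A coefficient -1 at j needs Q (y - L) < j < Q y. All points of the window lie in (N - Q,
  N], which confines the row y to \<open>{N div Q..N div Q + L}\<close>.\<close>

lemma segment_lower:
  assumes N: "0 \<le> N" "N < P * Q" and "0 \<le> A" "B \<le> P"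
  shows "- (L + 1) \<le> (\<Sum>i\<in>{A..<B}. a (N - K * i))"
proof -
  let ?I = "{i \<in> {A..<B}. a (N - K * i) = -1}"
  have "card ?I \<le> card {N div Q..N div Q + L}"
  proof (rule card_inj_on_le)
    show "inj_on (\<lambda>i. y (N - K * i)) ?I"
      by (rule inj_on_subset[OF y_step_inj]) (use assms in auto)
    show "(\<lambda>i. y (N - K * i)) ` ?I \<subseteq> {N div Q..N div Q + L}"
    proof (rule image_subsetI)
      fix i assume i: "i \<in> ?I"
      define j where "j = N - K * i"
      have j: "N - Q < j" "-Q < j" "j < P * Q" "j \<le> N"
        unfolding j_def using i assms(3,4) step_range[OF N, of i] by auto
      have "a j = -1" using i by (simp add: j_def)
      then have yj: "Q * (y j - L) < j" "j < Q * y j"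
        using a_values[OF j(2,3)] by (auto split: if_splits)
      have N': "Q * (N div Q) \<le> N" "N < Q * (N div Q + 1)"
        using mult_div_mod_eq[of Q N] pos_mod_bound[OF Q_pos, of N] pos_mod_sign[OF Q_pos, of N]
        unfolding distrib_left by linarith+
      have "Q * (N div Q - 1) < Q * y j" using N' yj j by (simp add: right_diff_distrib)
      then have "N div Q \<le> y j" using Q_pos by (simp add: mult_less_cancel_left)
      moreover have "Q * (y j - L) < Q * (N div Q + 1)" using N' yj j by linarith
      then have "y j - L < N div Q + 1" using Q_pos by (simp only: mult_less_cancel_left)
      ultimately show "y (N - K * i) \<in> {N div Q..N div Q + L}" by (simp add: j_def)
    qed
  qed simp
  then have "- (L + 1) \<le> - int (card ?I)" using L by simp
  also have "- int (card ?I) = (\<Sum>i\<in>{A..<B}. if a (N - K * i) = -1 then -1 else 0)"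
    by (simp add: sum.If_cases Int_def)
  also have "\<dots> \<le> (\<Sum>i\<in>{A..<B}. a (N - K * i))"
    using assms a_values[OF step_range(2,3)[OF N]] by (intro sum_mono) (auto split: if_splits)
  finally show ?thesis .
qed

text \<open>With \<open>K = 1\<close> a window consists of consecutive indices. This gives the bound
  1 needed for height 1, where \<open>segment_lower\<close> yields only L + 1 = 2.\<close>

lemma segment_telescope:
  assumes "K = 1" "A \<le> B"
  shows "(\<Sum>i\<in>{A..<B}. a (N - K * i)) = D (N - A) - D (N - B)"
proof -
  have "(\<Sum>i\<in>{A..<A + int n}. a (N - K * i)) = D (N - A) - D (N - (A + int n))" for n
  proof (induction n)
    case (Suc n)
    have "{A..<A + int (Suc n)} = insert (A + int n) {A..<A + int n}" by auto
    then show ?case using Suc assms by (simp add: a_def algebra_simps)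
  qed simp
  from this[of "nat (B - A)"] show ?thesis using assms by simp
qed

text \<open>
  E n is the coefficient of x^n in A(x^R) / (1 - x^(P Q)), where A is the binary polynomial, and c n is
  the one in the ternary polynomial.
\<close>

definition E :: "int \<Rightarrow> int" where
  "E n = (if R * ((K * n) mod (P * Q)) \<le> n then a (K * n) else 0)"

definition c :: "int \<Rightarrow> int" where
  "c n = (\<Sum>i\<in>{0..<P}. E (n - i)) - (\<Sum>i\<in>{0..<P}. E (n - Q - i))"

lemma E_window:
  assumes N: "N = (K * n) mod (P * Q)" and i: "0 \<le> i" "i < P"
  shows "E (n - i) = (if R * (N - K * i) + i \<le> n then a (N - K * i) else 0)"
proof -
  have N': "0 \<le> N" "N < P * Q" using N PQ_pos by auto
  have mod_eq: "(K * (n - i)) mod (P * Q) = (N - K * i) mod (P * Q)"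
    unfolding N by (simp add: right_diff_distrib mod_diff_left_eq)
  then have a_eq: "a (K * (n - i)) = a (N - K * i)" by (rule a_cong)
  show ?thesis
  proof (cases "0 \<le> N - K * i")
    case True
    then have "(K * (n - i)) mod (P * Q) = N - K * i"
      unfolding mod_eq using step_range[OF N' i] by (simp add: mod_pos_pos_trivial)
    then show ?thesis using a_eq by (simp add: E_def)
  next
    case False
    \<comment> \<open>Below 0 the reduction modulo P Q moves the index, so the two truncation
      conditions may differ; the coefficient is 0 there anyway.\<close>
    then have "a (N - K * i) = 0" using step_range[OF N' i] by (intro a_zero_negative) auto
    then show ?thesis using a_eq by (simp add: E_def)
  qed
qed

lemma RK_ge: "R * K \<ge> 1"
  using R_pos K by (metis int_one_le_iff_zero_less mult_pos_pos)

lemma cut_mono: 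
  assumes "i \<le> j" shows "R * (N - K * j) + j \<le> R * (N - K * i) + i"
proof -
  have "1 * (j - i) \<le> (R * K) * (j - i)" using RK_ge assms by (intro mult_right_mono) auto
  then show ?thesis by (simp add: algebra_simps)
qed

text \<open>Exponents decrease along a window, so truncation keeps a final segment;
  \<open>i0 = P\<close> means that nothing survives.\<close>

lemma cut_exists:
  obtains i0 where "0 \<le> i0" "i0 \<le> P" 
    "\<And>i. 0 \<le> i \<Longrightarrow> i < P \<Longrightarrow> R * (N - K * i) + i \<le> n \<longleftrightarrow> i0 \<le> i"
proof -
  let ?S = "{i \<in> {0..<P}. R * (N - K * i) + i \<le> n}"
  show ?thesis
  proof (cases "?S = {}")
    case True
    show ?thesis by (rule that[of P]) (use True P in auto)
  next
    case False
    have "finite ?S" by (rule finite_subset[of _ "{0..<P}"]) auto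
    then have "Min ?S \<in> ?S" "\<And>i. i \<in> ?S \<Longrightarrow> Min ?S \<le> i" using False Min_in by (blast, simp)
    then show ?thesis using cut_mono[of "Min ?S" _ N] by (intro that[of "Min ?S"]) (auto intro: order_trans)
  qed
qed

lemma sum_cut:
  assumes "0 \<le> i0" "i0 \<le> P"
    and "\<And>i. 0 \<le> i \<Longrightarrow> i < P \<Longrightarrow> e i = (if i0 \<le> i then f i else (0::int))"
  shows "(\<Sum>i\<in>{0..<P}. e i) = (\<Sum>i\<in>{i0..<P}. f i)"
  using assms by (intro sum.mono_neutral_cong_right) auto

lemma sum_split_int:
  fixes f :: "int \<Rightarrow> int"
  assumes "0 \<le> i0" "i0 \<le> P"
  shows "(\<Sum>i\<in>{0..<P}. f i) = (\<Sum>i\<in>{0..<i0}. f i) + (\<Sum>i\<in>{i0..<P}. f i)"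
proof -
  have "{0..<P} = {0..<i0} \<union> {i0..<P}" using assms by auto
  then show ?thesis by (simp only:) (rule sum.union_disjoint, auto)
qed

text \<open>The two starting points differ by a multiple of \<open>Q\<close>, which is nonzero
  because \<open>P\<close> does not divide \<open>K\<close>.\<close>

lemma window_positions:
  assumes "0 \<le> N" "N < P * Q"
  shows "(N - K * Q) mod (P * Q) \<le> N - Q \<or> N + Q \<le> (N - K * Q) mod (P * Q)"
proof -
  let ?M = "(N - K * Q) mod (P * Q)"
  have "?M = N - K * Q - P * Q * ((N - K * Q) div (P * Q))" by (simp add: minus_mult_div_eq_mod)
  then have M: "?M - N = Q * (- K - P * ((N - K * Q) div (P * Q)))" by (simp add: algebra_simps)
  define z where "z = - K - P * ((N - K * Q) div (P * Q))"
  have "z \<noteq> 0"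
  proof
    assume "z = 0"
    then have "K = P * (- ((N - K * Q) div (P * Q)))" by (simp add: z_def)
    then have "P dvd K" by (metis dvd_triv_left)
    then have "(L * K) mod P = 0" by simp
    then show False using LK by simp
  qed
  then have "z \<le> -1 \<or> 1 \<le> z" by linarith
  then have "Q * z \<le> Q * (-1) \<or> Q * 1 \<le> Q * z" using Q_pos by (metis mult_left_mono less_imp_le)
  then show ?thesis using M unfolding z_def by linarith
qed

lemma c_windows:
  assumes n: "N = (K * n) mod (P * Q)" and M: "M = (N - K * Q) mod (P * Q)"
  shows "0 \<le> N" "N < P * Q" "0 \<le> M" "M < P * Q"
    "0 \<le> i \<Longrightarrow> i < P \<Longrightarrow> E (n - i) = (if R * (N - K * i) + i \<le> n then a (N - K * i) else 0)"
    "0 \<le> i \<Longrightarrow> i < P \<Longrightarrow> E (n - Q - i) = (if R * (M - K * i) + i \<le> n - Q then a (M - K * i) else 0)"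
proof -
  show "0 \<le> N" "N < P * Q" "0 \<le> M" "M < P * Q" using n M PQ_pos by auto
  have "M = (K * (n - Q)) mod (P * Q)" unfolding M n by (simp add: right_diff_distrib mod_diff_left_eq)
  then show "0 \<le> i \<Longrightarrow> i < P \<Longrightarrow> E (n - Q - i) = (if R * (M - K * i) + i \<le> n - Q then a (M - K * i) else 0)"
    by (rule E_window)
  show "0 \<le> i \<Longrightarrow> i < P \<Longrightarrow> E (n - i) = (if R * (N - K * i) + i \<le> n then a (N - K * i) else 0)"
    using n by (rule E_window)
qed

text \<open>As windows are shorter than \<open>Q\<close>, the second lies entirely below the first;
  a gap of one index costs \<open>R\<close>, more than the offset i' and the shift \<open>Q\<close>
  can recover.\<close>

lemma second_window_below:
  assumes "M \<le> N - Q" "0 \<le> i" "i < P" "0 \<le> i'" "i' < P" "R * (N - K * i) + i \<le> n"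
  shows "R * (M - K * i') + i' \<le> n - Q"
proof -
  have "K * i \<le> K * P - K" using assms K mult_left_mono[of i "P - 1" K] by (simp add: right_diff_distrib)
  then have "M - K * i' + 1 \<le> N - K * i"
    using assms Q K by (smt (verit) mult_nonneg_nonneg)
  then have "R * (M - K * i' + 1) \<le> R * (N - K * i)" using R_pos by (intro mult_left_mono) auto
  then show ?thesis using assms R by (simp add: distrib_left)
qed

lemma first_window_below:
  assumes "N + Q \<le> M" "0 \<le> i" "i < P" "0 \<le> i'" "i' < P" "R * (M - K * i') + i' \<le> n - Q"
  shows "R * (N - K * i) + i \<le> n"
proof -
  have "K * i' \<le> K * P - K" using assms K mult_left_mono[of i' "P - 1" K] by (simp add: right_diff_distrib)
  then have "N - K * i + 1 \<le> M - K * i'"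
    using assms Q K by (smt (verit) mult_nonneg_nonneg)
  then have "R * (N - K * i + 1) \<le> R * (M - K * i')" using R_pos by (intro mult_left_mono) auto
  then show ?thesis using assms R Q_pos by (simp add: distrib_left)
qed

text \<open>At most one window is properly cut. If the other is empty, one segment remains; if it is
  complete, equality of the full sums turns the difference into a complementary segment.
  \<open>H\<close> is a parameter because \<open>K = 1\<close> needs its own bound.\<close>

lemma abs_c_le:
  assumes seg: "\<And>N A B. 0 \<le> N \<Longrightarrow> N < P * Q \<Longrightarrow> 0 \<le> A \<Longrightarrow> A \<le> B \<Longrightarrow> B \<le> P \<Longrightarrow> 
      \<bar>\<Sum>i\<in>{A..<B}. a (N - K * i)\<bar> \<le> H"
  shows "\<bar>c n\<bar> \<le> H"
proof -
  define N M where "N = (K * n) mod (P * Q)" and "M = (N - K * Q) mod (P * Q)"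
  note w = c_windows[OF N_def M_def]
  obtain i0 where i0: "0 \<le> i0" "i0 \<le> P" 
    "\<And>i. 0 \<le> i \<Longrightarrow> i < P \<Longrightarrow> R * (N - K * i) + i \<le> n \<longleftrightarrow> i0 \<le> i"
    using cut_exists[of N n] by blast
  obtain i1 where i1: "0 \<le> i1" "i1 \<le> P" 
    "\<And>i. 0 \<le> i \<Longrightarrow> i < P \<Longrightarrow> R * (M - K * i) + i \<le> n - Q \<longleftrightarrow> i1 \<le> i"
    using cut_exists[of M "n - Q"] by blast
  have c: "c n = (\<Sum>i\<in>{i0..<P}. a (N - K * i)) - (\<Sum>i\<in>{i1..<P}. a (M - K * i))"
    unfolding c_def using w i0 i1 by (intro arg_cong2[of _ _ _ _ "(-)"] sum_cut) auto
  have full: "(\<Sum>i\<in>{0..<P}. a (M - K * i)) = (\<Sum>i\<in>{0..<P}. a (N - K * i))"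
    unfolding M_def by (rule window_sum_shift_K)
  have cases: "i0 = P \<or> i1 = P \<or> i0 = 0 \<or> i1 = 0"
  proof (rule ccontr)
    assume *: "\<not> ?thesis"
    then have **: "0 < i0" "i0 < P" "0 < i1" "i1 < P" using i0 i1 by auto
    from window_positions[OF w(1,2)] show False
    proof
      assume "(N - K * Q) mod (P * Q) \<le> N - Q"
      then have "R * (M - K * 0) + 0 \<le> n - Q"
        using i0(3)[of i0] ** P by (intro second_window_below[of M N i0 0]) (auto simp: M_def)
      then show False using i1(3)[of 0] ** P by simp
    next
      assume "N + Q \<le> (N - K * Q) mod (P * Q)"
      then have "R * (N - K * 0) + 0 \<le> n"
        using i1(3)[of i1] ** P by (intro first_window_below[of N M 0 i1]) (auto simp: M_def)
      then show False using i0(3)[of 0] ** P by simp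
    qed
  qed
  then consider "i0 = P" | "i1 = P" | "i0 = 0" | "i1 = 0" by blast
  then show ?thesis
  proof cases
    case 1
    then show ?thesis using c seg[OF w(3,4) i1(1,2)] by simp
  next
    case 2
    then show ?thesis using c seg[OF w(1,2) i0(1,2)] by simp
  next
    case 3
    then have "c n = (\<Sum>i\<in>{0..<i1}. a (M - K * i))"
      using c full sum_split_int[OF i1(1,2), of "\<lambda>i. a (M - K * i)"] by simp
    then show ?thesis using seg[OF w(3,4) _ i1(1,2)] by simp
  next
    case 4
    then have "c n = - (\<Sum>i\<in>{0..<i0}. a (N - K * i))"
      using c full sum_split_int[OF i0(1,2), of "\<lambda>i. a (N - K * i)"] by simp
    then show ?thesis using seg[OF w(1,2) _ i0(1,2)] by simp
  qed
qed

lemma c_eventually_0: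
  assumes "R * (P * Q) + P + Q \<le> n"
  shows "c n = 0"
proof -
  define N M where "N = (K * n) mod (P * Q)" and "M = (N - K * Q) mod (P * Q)"
  note w = c_windows[OF N_def M_def]
  have *: "R * (X - K * i) + i \<le> n - Q" if "X < P * Q" "0 \<le> i" "i < P" for X i
  proof -
    have "X - K * i \<le> P * Q" using that K by (smt (verit) mult_nonneg_nonneg)
    then have "R * (X - K * i) \<le> R * (P * Q)" using R_pos by (intro mult_left_mono) auto
    then show ?thesis using that assms by linarith
  qed
  have "(\<Sum>i\<in>{0..<P}. E (n - i)) = (\<Sum>i\<in>{0..<P}. a (N - K * i))"
    using w *[OF w(2)] Q_pos by (intro sum.cong refl) force
  moreover have "(\<Sum>i\<in>{0..<P}. E (n - Q - i)) = (\<Sum>i\<in>{0..<P}. a (M - K * i))"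
    using w *[OF w(4)] by (intro sum.cong refl) force
  ultimately show ?thesis
    unfolding c_def M_def using window_sum_shift_K by simp
qed

text \<open>The index n = R (N - K i0) + i0 truncates the first window exactly at i0.\<close>

lemma c_cut:
  assumes N: "0 \<le> N" "N < P * Q" and i0: "0 \<le> i0" "i0 < P" "0 \<le> N - K * i0"
  shows "(N - K * Q) mod (P * Q) \<le> N - Q \<Longrightarrow> 
           c (R * (N - K * i0) + i0) = - (\<Sum>i\<in>{0..<i0}. a (N - K * i))"
    and "N + Q \<le> (N - K * Q) mod (P * Q) \<Longrightarrow> 
           c (R * (N - K * i0) + i0) = (\<Sum>i\<in>{i0..<P}. a (N - K * i))"
proof -
  define n where "n = R * (N - K * i0) + i0"
  define M where "M = (N - K * Q) mod (P * Q)"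
  have "K * n = (K * R) * (N - K * i0) + K * i0" by (simp add: n_def algebra_simps)
  then have "(K * n) mod (P * Q) = (1 * (N - K * i0) + K * i0) mod (P * Q)"
    using KR by (metis mod_add_left_eq mod_mult_left_eq)
  then have Nn: "N = (K * n) mod (P * Q)" using N by (simp add: mod_pos_pos_trivial)
  note w = c_windows[OF Nn M_def]
  have cut: "R * (N - K * i) + i \<le> n \<longleftrightarrow> i0 \<le> i" if "0 \<le> i" "i < P" for i
  proof
    assume le: "R * (N - K * i) + i \<le> n"
    show "i0 \<le> i"
    proof (rule ccontr)
      assume "\<not> i0 \<le> i"
      \<comment> \<open>R K >= 2 makes the exponents strictly decreasing, so no position before
        \<open>i0\<close> survives.\<close>
      then have "2 * (i0 - i) \<le> (R * K) * (i0 - i)"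
      proof (intro mult_right_mono)
        have "2 * 1 \<le> R * K" using R P Q_pos K by (intro mult_mono) auto
        then show "2 \<le> R * K" by simp
      qed auto
      then show False using le \<open>\<not> i0 \<le> i\<close> by (simp add: n_def algebra_simps)
    qed
  next
    assume "i0 \<le> i"
    then show "R * (N - K * i) + i \<le> n" unfolding n_def by (rule cut_mono)
  qed
  have first: "(\<Sum>i\<in>{0..<P}. E (n - i)) = (\<Sum>i\<in>{i0..<P}. a (N - K * i))"
    using w(5) cut i0 by (intro sum_cut) auto
  show "c (R * (N - K * i0) + i0) = - (\<Sum>i\<in>{0..<i0}. a (N - K * i))"
    if "(N - K * Q) mod (P * Q) \<le> N - Q"
  proof -
    have "R * (M - K * i) + i \<le> n - Q" if "0 \<le> i" "i < P" for i
      using \<open>_ \<le> N - Q\<close> that i0 by (intro second_window_below[of M N i0]) (auto simp: M_def n_def)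
    then have "(\<Sum>i\<in>{0..<P}. E (n - Q - i)) = (\<Sum>i\<in>{0..<P}. a (M - K * i))"
      using w(6) by (intro sum.cong refl) auto
    also have "\<dots> = (\<Sum>i\<in>{0..<P}. a (N - K * i))" unfolding M_def by (rule window_sum_shift_K)
    also have "\<dots> = (\<Sum>i\<in>{0..<i0}. a (N - K * i)) + (\<Sum>i\<in>{i0..<P}. a (N - K * i))"
      using i0 by (intro sum_split_int) auto
    finally show ?thesis using first unfolding c_def n_def by simp
  qed
  show "c (R * (N - K * i0) + i0) = (\<Sum>i\<in>{i0..<P}. a (N - K * i))"
    if "N + Q \<le> (N - K * Q) mod (P * Q)"
  proof -
    have "\<not> R * (M - K * i) + i \<le> n - Q" if "0 \<le> i" "i < P" for i
    proof
      assume *: "R * (M - K * i) + i \<le> n - Q"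
      have "K * i \<le> K * P" using that K by auto
      then have "N + 1 \<le> M - K * i" using \<open>N + Q \<le> _\<close> Q by (simp add: M_def)
      then have "R * (N + 1) \<le> R * (M - K * i)" using R_pos by (intro mult_left_mono) auto
      moreover have "R * (N - K * i0) \<le> R * N" using R_pos K i0 by (intro mult_left_mono) auto
      ultimately show False using * that i0 R Q_pos unfolding n_def distrib_left by linarith
    qed
    then have "(\<Sum>i\<in>{0..<P}. E (n - Q - i)) = 0"
      using w(6) by (intro sum.neutral) auto
    then show ?thesis using first unfolding c_def n_def by simp
  qed
qed

text \<open>The start N = v Q + 1 lies in row P - 1, so its window visits rows P - 1, ..., P - 1 -
  L. The choice of v makes N - 1 the lower threshold for coefficient -1 at the first visit, and the
  upper one at the last. The added 1 makes the former strict, and K L > P the latter; 2 L + 1 <= P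
  keeps all these rows at least L.\<close>

lemma c_attained:
  assumes KL: "P < K * L" and PL: "2 * L + 1 \<le> P"
  obtains n where "0 \<le> n" "\<bar>c n\<bar> = L + 1"
proof -
  define v where "v = P - 1 - L"
  define N where "N = v * Q + 1"
  have v: "L \<le> v" "v < P" "1 \<le> v" using PL L by (auto simp: v_def)
  have vQ: "Q * 1 \<le> v * Q" "v * Q \<le> (P - 1) * Q" using v L Q_pos by (auto simp: v_def)
  have KPL: "K * L \<le> K * P - K" using L K mult_left_mono[of L "P - 1" K] by (simp add: right_diff_distrib)
  have N: "0 \<le> N" "N < P * Q" using vQ Q KP_pos Q_pos by (auto simp: N_def algebra_simps)
  have LN: "(L * N) mod P = P - 1"
  proof -
    have "(L * N) mod P = (v * (L * Q) + L) mod P" by (simp add: N_def algebra_simps)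
    also have "\<dots> = (v * 1 + L) mod P" using LQ by (metis mod_add_left_eq mod_mult_right_eq)
    also have "v * 1 + L = P - 1" by (simp add: v_def)
    also have "(P - 1) mod P = P - 1" using P by (intro mod_pos_pos_trivial) auto
    finally show ?thesis .
  qed
  have val: "a (N - K * i) = -1" if i: "0 \<le> i" "i \<le> L" for i
  proof -
    have iP: "i < P" using i L by simp
    have "y (N - K * i) = (P - 1 - i) mod P" unfolding y_step using LN by (metis mod_diff_left_eq)
    then have y: "y (N - K * i) = P - 1 - i" using i iP by (simp add: mod_pos_pos_trivial)
    have "L \<le> P - 1 - i" using i PL by simp
    moreover have "Q * (P - 1 - i - L) < N - K * i"
    proof -
      have "K * i \<le> Q * i" using i Q K_le P_le KP_pos by (intro mult_right_mono) auto
      then show ?thesis by (simp add: N_def v_def algebra_simps)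
    qed
    moreover have "N - K * i < Q * (P - 1 - i)"
    proof (cases "i = L")
      case True
      then show ?thesis using KL P by (simp add: N_def v_def algebra_simps)
    next
      case False
      then have "Q * 1 \<le> Q * (L - i)" using i Q_pos by (intro mult_left_mono) auto
      moreover have "0 \<le> K * i" using K i by simp
      ultimately show ?thesis using Q KP_pos by (simp add: N_def v_def algebra_simps)
    qed
    ultimately show ?thesis using a_values[OF step_range(2,3)[OF N i(1) iP]] y by simp
  qed
  from window_positions[OF N] show ?thesis
  proof
    assume below: "(N - K * Q) mod (P * Q) \<le> N - Q"
    have N0: "0 \<le> N - K * (L + 1)" using KPL vQ Q by (simp add: N_def algebra_simps)
    have "c (R * (N - K * (L + 1)) + (L + 1)) = - (\<Sum>i\<in>{0..<L + 1}. a (N - K * i))"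
      using L PL N0 by (intro c_cut(1)[OF N _ _ _ below]) auto
    also have "(\<Sum>i\<in>{0..<L + 1}. a (N - K * i)) = (\<Sum>i\<in>{0..<L + 1}. -1)"
      using val by (intro sum.cong) auto
    also have "\<dots> = - (L + 1)" using L by simp
    finally show ?thesis using L N0 R_pos by (intro that[of "R * (N - K * (L + 1)) + (L + 1)"]) auto
  next
    assume above: "N + Q \<le> (N - K * Q) mod (P * Q)"
    \<comment> \<open>Only final segments are available in this case, so the start is moved back by
      v steps: the run of L + 1 coefficients -1 then occupies positions v, ..., P - 1.\<close>
    define N' where "N' = N + K * v"
    have Kv: "0 \<le> K * v" "K * v \<le> K * P" using K v by auto
    have N': "0 \<le> N'" "N' < P * Q"
      using N Kv above vQ Q KP_pos by (auto simp: N'_def)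
         (smt (verit) pos_mod_bound PQ_pos)
    \<comment> \<open>The companion start is 1 modulo Q, hence at most P Q - Q + 1, and K v <= Q -
      2; adding K v therefore causes no reduction.\<close>
    have mod': "(N' - K * Q) mod (P * Q) = (N - K * Q) mod (P * Q) + K * v"
    proof -
      have "(N' - K * Q) mod (P * Q) = ((N - K * Q) mod (P * Q) + K * v) mod (P * Q)"
      proof -
        have "N' - K * Q = (N - K * Q) + K * v" by (simp add: N'_def)
        then show ?thesis by (simp only: mod_add_left_eq)
      qed
      moreover have "(N - K * Q) mod (P * Q) + K * v < P * Q"
      proof -
        have "((N - K * Q) mod (P * Q)) mod Q = 1"
        proof -
          have "((N - K * Q) mod (P * Q)) mod Q = (N - K * Q) mod Q" by (simp add: mod_mult_right_eq mod_mod_cancel)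
          also have "\<dots> = (1 + (v - K) * Q) mod Q" by (simp add: N_def algebra_simps)
          also have "\<dots> = 1" using Q KP_pos by (simp add: mod_pos_pos_trivial)
          finally show ?thesis .
        qed
        then have "(N - K * Q) mod (P * Q) = Q * ((N - K * Q) mod (P * Q) div Q) + 1"
          using mult_div_mod_eq[of Q "(N - K * Q) mod (P * Q)"] by linarith
        moreover have "(N - K * Q) mod (P * Q) div Q \<le> P - 1"
        proof -
          have "(N - K * Q) mod (P * Q) < P * Q" using PQ_pos by simp
          then have "Q * ((N - K * Q) mod (P * Q) div Q) < Q * P"
            using mult_div_mod_eq[of Q "(N - K * Q) mod (P * Q)"] pos_mod_sign[OF Q_pos, of "(N - K * Q) mod (P * Q)"]
              mult.commute[of P Q] by linarith
          then have "(N - K * Q) mod (P * Q) div Q < P" using Q_pos by (simp only: mult_less_cancel_left)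
          then show ?thesis by simp
        qed
        then have "Q * ((N - K * Q) mod (P * Q) div Q) \<le> Q * (P - 1)" using Q_pos by (intro mult_left_mono) auto
        ultimately show ?thesis using Kv Q by (simp add: algebra_simps)
      qed
      ultimately show ?thesis using Kv PQ_pos by (simp add: mod_pos_pos_trivial)
    qed
    have N0: "0 \<le> N' - K * v" using N by (simp add: N'_def)
    have "c (R * (N' - K * v) + v) = (\<Sum>i\<in>{v..<P}. a (N' - K * i))"
      using v L N0 above mod' by (intro c_cut(2)[OF N']) (auto simp: N'_def)
    also have "\<dots> = (\<Sum>i\<in>{v..<P}. -1)"
    proof (intro sum.cong refl)
      fix i assume "i \<in> {v..<P}"
      then have "a (N - K * (i - v)) = -1" using v by (intro val) (auto simp: v_def)
      then show "a (N' - K * i) = -1" by (simp add: N'_def algebra_simps)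
    qed
    also have "\<dots> = - (L + 1)" using L by (simp add: v_def)
    finally show ?thesis using L v N0 R_pos by (intro that[of "R * (N' - K * v) + v"]) auto
  qed
qed

end

section \<open>Power series and the ternary polynomial\<close>

lemma one_minus_fps_X_power_mult_nth:
  fixes f :: "'a::comm_ring_1 fps"
  shows "fps_nth ((1 - fps_X ^ m) * f) n = fps_nth f n - (if n < m then 0 else fps_nth f (n - m))"
  by (simp add: left_diff_distrib fps_X_power_mult_nth)

lemma pcompose_monom: "pcompose (monom c n) p = smult c (p ^ n)" for p :: "'a::comm_ring_1 poly"
  by (induction n) (simp_all add: monom_0 monom_Suc pcompose_pCons)

lemma monom_power_monom: "monom (1::'a::comm_ring_1) r ^ n = monom 1 (r * n)"
  by (induction n) (simp_all add: mult_monom monom_0 one_pCons)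

locale ternary_polynomial = ternary_parameters "int p" "int q" "int r" K L
  for p q r :: nat and K L :: int
begin

lemma pqr_pos: "p > 0" "q > 0" "r > 0"
  using P Q_pos R_pos by auto

text \<open>The generating series of the numerical semigroup generated by \<open>p\<close> and
  \<open>q\<close>.\<close>

definition s_fps :: "int fps" where
  "s_fps = Abs_fps (\<lambda>n. if int q * y (int n) \<le> int n then 1 else 0)"

definition A_poly :: "int poly" where
  "A_poly = (\<Sum>j<p * q. monom (a (int j)) j)"

definition E_fps :: "int fps" where "E_fps = Abs_fps (\<lambda>n. E (int n))"

definition c_fps :: "int fps" where "c_fps = Abs_fps (\<lambda>n. c (int n))"

lemma s_large: "p * q - q \<le> n \<Longrightarrow> int q * y (int n) \<le> int n"
proof -
  assume "p * q - q \<le> n"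
  then have "int p * int q - int q \<le> int n" by (simp flip: of_nat_mult)
  then show ?thesis using Qy_le[of "int n"] by linarith
qed

lemma s_fps_nth: "n < p * q \<Longrightarrow> fps_nth s_fps n = D (int n) + 1"
  using D_eq[of "int n"] by (auto simp: s_fps_def simp flip: of_nat_mult)

lemma s_fps_nth_large: "p * q - q \<le> n \<Longrightarrow> fps_nth s_fps n = 1"
  by (simp add: s_fps_def s_large)

lemma q_le_pq: "q \<le> p * q"
  using pqr_pos by simp

lemma q_shift_s_fps: 
  "(1 - fps_X ^ q) * s_fps = Abs_fps (\<lambda>n. if p dvd n \<and> n < p * q then 1 else 0)"
proof (rule fps_ext)
  fix n
  show "fps_nth ((1 - fps_X ^ q) * s_fps) n = fps_nth (Abs_fps (\<lambda>n. if p dvd n \<and> n < p * q then 1 else 0)) n"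
  proof (cases "n < p * q")
    case True
    have "(if n < q then 0 else fps_nth s_fps (n - q)) = D (int n - int q) + 1"
    proof (cases "n < q")
      case True
      then have "D (int n - int q) = -1"
        using D_eq[of "int n - int q"] Qy_nonneg[of "int n - int q"] PQ_pos by auto
      then show ?thesis using True by simp
    next
      case False
      then show ?thesis using True s_fps_nth[of "n - q"] by (simp add: of_nat_diff)
    qed
    then show ?thesis
      using True D_shift[of "int n"] by (auto simp: one_minus_fps_X_power_mult_nth s_fps_nth)
  next
    case False
    then have "p * q - q \<le> n" "p * q - q \<le> n - q" "\<not> n < q" using q_le_pq by linarith+
    then show ?thesis using False
      by (simp add: one_minus_fps_X_power_mult_nth s_fps_nth_large)
  qed
qed

lemma pq_shift_s_fps: "(1 - fps_X ^ p) * ((1 - fps_X ^ q) * s_fps) = 1 - fps_X ^ (p * q)"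
proof (rule fps_ext)
  fix n
  have "fps_nth ((1 - fps_X ^ p) * ((1 - fps_X ^ q) * s_fps)) n
      = (if p dvd n \<and> n < p * q then 1 else 0) - (if n < p then 0 else if p dvd n - p \<and> n - p < p * q then 1 else 0)"
    by (simp add: one_minus_fps_X_power_mult_nth q_shift_s_fps)
  also have "\<dots> = (if n = 0 then 1 else 0) - (if n = p * q then 1 else 0)"
  proof (cases "p dvd n")
    case True
    then obtain t where t: "n = p * t" by (elim dvdE)
    show ?thesis
    proof (cases t)
      case (Suc t')
      then have np: "n - p = p * t'" "\<not> n < p" "n \<noteq> 0" using pqr_pos by (auto simp: t)
      have "n < p * q \<longleftrightarrow> Suc t' < q" "n - p < p * q \<longleftrightarrow> t' < q" "n = p * q \<longleftrightarrow> Suc t' = q"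
        unfolding np(1) unfolding t Suc using pqr_pos by (simp_all del: mult_Suc_right)
      then show ?thesis using np t by auto
    qed (use t pqr_pos in auto)
  next
    case False
    then have "p \<le> n \<Longrightarrow> \<not> p dvd n - p" "n \<noteq> p * q" by (auto dest: dvd_diffD)
    moreover have "n \<noteq> 0" using False by (intro notI) simp
    ultimately show ?thesis using False by auto
  qed
  also have "\<dots> = fps_nth (1 - fps_X ^ (p * q)) n" by (simp add: fps_X_power_nth)
  finally show "fps_nth ((1 - fps_X ^ p) * ((1 - fps_X ^ q) * s_fps)) n = fps_nth (1 - fps_X ^ (p * q)) n" .
qed

lemma coeff_A_poly: "coeff A_poly n = (if n < p * q then a (int n) else 0)"
  by (simp add: A_poly_def coeff_sum if_distrib[of "\<lambda>x. x = _"] cong: if_cong)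

lemma fps_A_poly: "fps_of_poly A_poly = (1 - fps_X) * s_fps"
proof (rule fps_ext)
  fix n
  have "fps_nth ((1 - fps_X ^ 1) * s_fps) n = coeff A_poly n"
  proof (cases "n < p * q")
    case True
    have "(if n < 1 then 0 else fps_nth s_fps (n - 1)) = D (int n - 1) + 1"
    proof (cases n)
      case 0
      then have "D (int n - 1) = -1"
        using D_eq[of "int n - 1"] Qy_nonneg[of "int n - 1"] PQ_pos Q_pos by auto
      then show ?thesis using 0 by simp
    next
      case (Suc n')
      then show ?thesis using True s_fps_nth[of n'] by simp
    qed
    then show ?thesis using True 
      by (simp only: one_minus_fps_X_power_mult_nth) (simp add: s_fps_nth coeff_A_poly a_def)
  next
    case False
    have "p * q - q \<le> n" "p * q - q \<le> n - 1" "\<not> n < 1" using False pqr_pos q_le_pq by (auto intro: Nat.gr0I)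
    then show ?thesis using False 
      by (simp only: one_minus_fps_X_power_mult_nth) (simp add: s_fps_nth_large coeff_A_poly)
  qed
  then show "fps_nth (fps_of_poly A_poly) n = fps_nth ((1 - fps_X) * s_fps) n" by simp
qed

lemma fps_of_poly_one_minus_monom: "fps_of_poly (1 - monom (1::int) n) = 1 - fps_X ^ n"
  by (simp add: fps_of_poly_diff fps_of_poly_monom)

lemma A_poly_identity:
  "(1 - monom 1 p) * (1 - monom 1 q) * A_poly = (1 - monom 1 1) * (1 - monom 1 (p * q))"
proof -
  have "fps_of_poly ((1 - monom 1 p) * (1 - monom 1 q) * A_poly)
      = (1 - fps_X) * ((1 - fps_X ^ p) * ((1 - fps_X ^ q) * s_fps))"
    by (simp add: fps_of_poly_mult fps_of_poly_one_minus_monom fps_A_poly mult_ac)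
  also have "\<dots> = fps_of_poly ((1 - monom 1 1) * (1 - monom 1 (p * q)))"
    unfolding pq_shift_s_fps fps_of_poly_mult fps_of_poly_one_minus_monom by simp
  finally show ?thesis by (simp only: fps_of_poly_eq_iff)
qed

definition Ar_poly :: "int poly" where "Ar_poly = pcompose A_poly (monom 1 r)"

lemma Ar_poly_identity:
  "(1 - monom 1 (r * p)) * (1 - monom 1 (q * r)) * Ar_poly = (1 - monom 1 r) * (1 - monom 1 (p * q * r))"
proof -
  have comp: "pcompose (1 - monom 1 n) (monom 1 r) = 1 - monom (1::int) (r * n)" for n
    by (simp add: pcompose_diff pcompose_1 pcompose_monom monom_power_monom)
  show ?thesis
    using arg_cong[OF A_poly_identity, of "\<lambda>f. pcompose f (monom 1 r)"]
    unfolding pcompose_mult comp Ar_poly_def by (simp add: mult_ac)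
qed

lemma coeff_Ar_poly: "coeff Ar_poly n = (\<Sum>j<p * q. if n = r * j then a (int j) else 0)"
  unfolding Ar_poly_def A_poly_def pcompose_sum
  by (intro trans[OF coeff_sum] sum.cong) (auto simp: pcompose_monom monom_power_monom)

text \<open>Modulo p q there is exactly one g < p q with r g = n, namely K n reduced. So division by
  1 - x^(p q) copies the coefficient at r g to all later exponents of its class, in particular to n
  once r g <= n.\<close>

lemma E_fps_identity: "(1 - fps_X ^ (p * q)) * E_fps = fps_of_poly Ar_poly"
proof (rule fps_ext)
  fix n
  define g where "g = nat ((K * int n) mod (int p * int q))"
  have g: "int g = (K * int n) mod (int p * int q)" using PQ_pos by (simp add: g_def)
  then have "int g < int p * int q" using PQ_pos by simp
  then have g_less: "g < p * q" by (simp flip: of_nat_mult)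
  have a_g: "a (K * int n) = a (int g)" using a_mod g by metis
  have rg: "(int r * int g) mod (int p * int q) = int n mod (int p * int q)"
  proof -
    have "(int r * int g) mod (int p * int q) = ((K * int r) * int n) mod (int p * int q)"
      unfolding g by (simp add: mod_mult_right_eq mult_ac)
    also have "\<dots> = int n mod (int p * int q)" using KR by (metis mod_mult_left_eq mult_1)
    finally show ?thesis .
  qed
  have uniq: "n = r * j \<longleftrightarrow> j = g \<and> n = r * g" if "j < p * q" for j
  proof
    assume n: "n = r * j"
    have "int g = ((K * int r) * int j) mod (int p * int q)" unfolding g n by (simp add: mult_ac)
    also have "\<dots> = int j mod (int p * int q)" using KR by (metis mod_mult_left_eq mult_1)
    also have "\<dots> = int j" using that by (simp flip: of_nat_mult of_nat_mod)
    finally show "j = g \<and> n = r * g" using n by simp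
  qed auto
  have "coeff Ar_poly n = (\<Sum>j<p * q. if j = g then (if n = r * g then a (int g) else 0) else 0)"
    unfolding coeff_Ar_poly
  proof (intro sum.cong refl)
    fix j assume "j \<in> {..<p * q}"
    then have "j < p * q" by simp
    then show "(if n = r * j then a (int j) else 0) = (if j = g then (if n = r * g then a (int g) else 0) else 0)"
      unfolding uniq[OF \<open>j < p * q\<close>] by (cases "j = g") auto
  qed
  also have "\<dots> = (if n = r * g then a (int g) else 0)" using g_less by simp
  finally have coeff: "coeff Ar_poly n = (if n = r * g then a (int g) else 0)" .
  have E_n: "E (int n) = (if r * g \<le> n then a (int g) else 0)"
    unfolding E_def a_g g[symmetric] by (simp flip: of_nat_mult)
  have eq: "n = r * g \<longleftrightarrow> r * g \<le> n \<and> \<not> (p * q \<le> n \<and> r * g \<le> n - p * q)"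
  proof
    assume *: "r * g \<le> n \<and> \<not> (p * q \<le> n \<and> r * g \<le> n - p * q)"
    have "int p * int q dvd int n - int r * int g" using rg by (simp add: mod_eq_dvd_iff dvd_diff_commute)
    then have "int (p * q) dvd int (n - r * g)" using * by (simp add: of_nat_diff)
    then have "p * q dvd n - r * g" by (simp only: of_nat_dvd_iff)
    moreover have "n - r * g < p * q" using * by auto
    ultimately have "n - r * g = 0" by (auto dest: dvd_imp_le)
    then show "n = r * g" using * by simp
  next
    assume "n = r * g"
    moreover have "0 < p * q" using pqr_pos by simp
    ultimately show "r * g \<le> n \<and> \<not> (p * q \<le> n \<and> r * g \<le> n - p * q)" by linarith
  qed
  have E_shift: "E (int (n - p * q)) = (if r * g \<le> n - p * q then a (int g) else 0)" if "p * q \<le> n"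
  proof -
    have "int (n - p * q) = int n - int p * int q" using that by (simp add: of_nat_diff)
    then have "K * int (n - p * q) = K * int n + int p * int q * (- K)"
      by (simp only:) (simp add: algebra_simps)
    then have "(K * int (n - p * q)) mod (int p * int q) = int g" "a (K * int (n - p * q)) = a (int g)"
      using g a_g a_period by (simp_all only: mod_mult_self2)
    then show ?thesis unfolding E_def by (simp flip: of_nat_mult)
  qed
  show "fps_nth ((1 - fps_X ^ (p * q)) * E_fps) n = fps_nth (fps_of_poly Ar_poly) n"
    using coeff E_n E_shift eq by (auto simp: one_minus_fps_X_power_mult_nth E_fps_def not_less)
qed

lemma E_negative: "n < 0 \<Longrightarrow> E n = 0"
proof -
  assume "n < 0"
  moreover have "0 \<le> int r * ((K * n) mod (int p * int q))" using R_pos PQ_pos by simp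
  ultimately show ?thesis by (simp add: E_def)
qed

text \<open>The quotient (1 - x^p) / (1 - x) is the finite sum of x^i for i < p; it is the origin of
  windows of length p.\<close>

lemma c_fps_eq: "c_fps = (\<Sum>i<p. fps_X ^ i) * ((1 - fps_X ^ q) * E_fps)"
proof (rule fps_ext)
  fix n
  have int_sum: "(\<Sum>i\<in>{0..<int p}. f i) = (\<Sum>i<p. f (int i))" for f :: "int \<Rightarrow> int"
    by (rule sum.reindex_bij_witness[of _ int nat]) auto
  have E': "(if n < i then 0 else E (int (n - i))) = E (int n - int i)" for n i
    using E_negative[of "int n - int i"] by (auto simp: of_nat_diff)
  have "fps_nth ((\<Sum>i<p. fps_X ^ i) * ((1 - fps_X ^ q) * E_fps)) n
      = (\<Sum>i<p. if n < i then 0 else fps_nth ((1 - fps_X ^ q) * E_fps) (n - i))"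
    by (simp add: sum_distrib_right fps_sum_nth fps_X_power_mult_nth)
  also have "\<dots> = (\<Sum>i<p. E (int n - int i) - E (int n - int q - int i))"
  proof (intro sum.cong refl)
    fix i
    have e: "fps_nth ((1 - fps_X ^ q) * E_fps) k = E (int k) - E (int k - int q)" for k
      using E'[of k q] E_negative[of "int k - int q"] by (auto simp: one_minus_fps_X_power_mult_nth E_fps_def)
    show "(if n < i then 0 else fps_nth ((1 - fps_X ^ q) * E_fps) (n - i)) 
        = E (int n - int i) - E (int n - int q - int i)"
    proof (cases "n < i")
      case True
      then show ?thesis
        using E_negative[of "int n - int i"] E_negative[of "int n - int q - int i"] by simp
    next
      case False
      then have "int (n - i) = int n - int i" "int (n - i) - int q = int n - int q - int i" by auto
      then show ?thesis using False e[of "n - i"] by (simp only: if_False)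
    qed
  qed
  also have "\<dots> = c (int n)" by (simp add: c_def int_sum sum_subtractf)
  finally show "fps_nth c_fps n = fps_nth ((\<Sum>i<p. fps_X ^ i) * ((1 - fps_X ^ q) * E_fps)) n"
    by (simp add: c_fps_def)
qed

lemma c_fps_identity: 
  "(1 - fps_X) * (1 - fps_X ^ (p * q)) * c_fps = (1 - fps_X ^ p) * (1 - fps_X ^ q) * fps_of_poly Ar_poly"
proof -
  have "(1 - fps_X) * (\<Sum>i<p. fps_X ^ i) = 1 - (fps_X :: int fps) ^ p"
    by (rule one_diff_power_eq[symmetric])
  moreover have "(1 - fps_X) * (1 - fps_X ^ (p * q)) * c_fps
      = ((1 - fps_X) * (\<Sum>i<p. fps_X ^ i)) * (1 - fps_X ^ q) * ((1 - fps_X ^ (p * q)) * E_fps)"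
    unfolding c_fps_eq by (simp only: mult_ac)
  ultimately show ?thesis by (simp only: E_fps_identity)
qed

definition c_poly :: "int poly" where
  "c_poly = (\<Sum>n<r * (p * q) + p + q. monom (c (int n)) n)"

lemma coeff_c_poly: "coeff c_poly n = c (int n)"
proof -
  have "coeff c_poly n = (if n < r * (p * q) + p + q then c (int n) else 0)"
    by (simp add: c_poly_def coeff_sum if_distrib[of "\<lambda>x. x = _"] cong: if_cong)
  moreover have "c (int n) = 0" if "\<not> n < r * (p * q) + p + q"
  proof (rule c_eventually_0)
    have "int (r * (p * q) + p + q) \<le> int n" using that by (simp only: of_nat_le_iff not_less)
    then show "int r * (int p * int q) + int p + int q \<le> int n" by simp
  qed
  ultimately show ?thesis by auto
qed

text \<open>Eliminating \<open>Ar_poly\<close> between two product identities shows that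
  \<open>c_poly\<close> times the denominator is the numerator, so \<open>div\<close> is exact.
  Numerator and denominator have four factors each, so passing from 1 - x^n to x^n - 1 leaves no
  sign.\<close>

lemma inclusion_exclusion_poly_eq: "inclusion_exclusion_poly p q r = c_poly"
proof -
  let ?m = "\<lambda>n. monom (1::int) n"
  have "fps_of_poly c_poly = c_fps" by (rule fps_ext) (simp add: coeff_c_poly c_fps_def)
  then have "fps_of_poly ((1 - ?m 1) * (1 - ?m (p * q)) * c_poly)
      = fps_of_poly ((1 - ?m p) * (1 - ?m q) * Ar_poly)"
    unfolding fps_of_poly_mult fps_of_poly_one_minus_monom using c_fps_identity by simp
  then have 1: "(1 - ?m 1) * (1 - ?m (p * q)) * c_poly = (1 - ?m p) * (1 - ?m q) * Ar_poly"
    by (simp only: fps_of_poly_eq_iff)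
  have neg: "x - 1 = - (1 - x)" for x :: "int poly" by simp
  have signs: "f * ((u - 1) * (v - 1) * (w - 1) * (z - 1)) = ((1 - z) * (1 - u) * f) * ((1 - w) * (1 - v))"
    for f u v w z :: "int poly"
    unfolding neg[of u] neg[of v] neg[of w] neg[of z]
    by (simp only: mult_minus_left mult_minus_right minus_minus mult_ac)
  have signs': "(1 - v) * (1 - w) * ((1 - z) * (1 - u)) = (u - 1) * (v - 1) * (w - 1) * (z - 1)"
    for u v w z :: "int poly"
    unfolding neg[of u] neg[of v] neg[of w] neg[of z]
    by (simp only: mult_minus_left mult_minus_right minus_minus mult_ac)
  define d where "d = (?m (p * q) - 1) * (?m (q * r) - 1) * (?m (r * p) - 1) * (?m 1 - 1)"
  have "c_poly * d = ((1 - ?m 1) * (1 - ?m (p * q)) * c_poly) * ((1 - ?m (r * p)) * (1 - ?m (q * r)))"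
    unfolding d_def by (rule signs)
  also have "\<dots> = (1 - ?m p) * (1 - ?m q) * ((1 - ?m (r * p)) * (1 - ?m (q * r)) * Ar_poly)"
    unfolding 1 by (simp add: mult_ac)
  also have "\<dots> = (?m (p * q * r) - 1) * (?m p - 1) * (?m q - 1) * (?m r - 1)"
    unfolding Ar_poly_identity by (rule signs')
  finally have eq: "c_poly * d = (?m (p * q * r) - 1) * (?m p - 1) * (?m q - 1) * (?m r - 1)" .
  have nz: "?m n \<noteq> 1" if "n > 0" for n
  proof
    assume "?m n = 1"
    then have "coeff (?m n) n = coeff 1 n" by simp
    then show False using that by (simp add: coeff_1)
  qed
  have "d \<noteq> 0" unfolding d_def using pqr_pos by (simp add: nz)
  then show ?thesis
    unfolding inclusion_exclusion_poly_def d_def[symmetric] eq[symmetric] by (rule nonzero_mult_div_cancel_right)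
qed

lemma ternary_height_eqI:
  assumes "\<And>n. \<bar>c n\<bar> \<le> H" "0 \<le> n0" "\<bar>c n0\<bar> = H" "H > 0"
  shows "ternary_height p q r = H"
proof -
  have "coeff c_poly (nat n0) \<noteq> 0" using assms by (simp add: coeff_c_poly)
  then have "nat n0 \<le> degree c_poly" by (rule le_degree)
  then show ?thesis
    unfolding ternary_height_def poly_height_def inclusion_exclusion_poly_eq
    using assms by (intro Max_eqI) (auto simp: coeff_c_poly intro!: image_eqI[of _ _ "nat n0"])
qed

lemma ternary_height_eq_Suc:
  assumes "int p < K * L" "2 * L + 1 \<le> int p"
  shows "ternary_height p q r = L + 1"
proof -
  obtain n where "0 \<le> n" "\<bar>c n\<bar> = L + 1" using c_attained[OF assms] by blast
  moreover have "\<bar>c n\<bar> \<le> L + 1" for n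
  proof (rule abs_c_le)
    fix N A B :: int assume "0 \<le> N" "N < int p * int q" "0 \<le> A" "A \<le> B" "B \<le> int p"
    then show "\<bar>\<Sum>i\<in>{A..<B}. a (N - K * i)\<bar> \<le> L + 1"
      using segment_upper[of N A B] segment_lower[of N A B] by linarith
  qed
  ultimately show ?thesis using L by (intro ternary_height_eqI) auto
qed

lemma ternary_height_eq_1:
  assumes "K = 1" 
  shows "ternary_height p q r = 1"
proof (rule ternary_height_eqI)
  show "\<bar>c n\<bar> \<le> 1" for n
  proof (rule abs_c_le)
    fix N A B :: int assume *: "0 \<le> N" "N < int p * int q" "0 \<le> A" "A \<le> B" "B \<le> int p"
    have "int p \<le> int q" using Q P_le by linarith
    then show "\<bar>\<Sum>i\<in>{A..<B}. a (N - K * i)\<bar> \<le> 1"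
      using * segment_telescope[OF assms *(4)] D_eq[of "N - A"] D_eq[of "N - B"] by auto
  qed
  \<comment> \<open>The constant coefficient is 1 and attains the bound.\<close>
  have "E (0 - i) = 0" if "i > 0" for i using E_negative[of "0 - i"] that by simp
  then have "(\<Sum>i\<in>{0..<int p}. E (0 - i)) = (\<Sum>i\<in>{0..<int p}. if i = 0 then E 0 else 0)"
    by (intro sum.cong) auto
  also have "\<dots> = E 0" using P by simp
  also have "E 0 = 1"
    using D_eq[of 0] D_eq[of "-1"] Qy_nonneg[of "-1"] Q_pos PQ_pos by (simp add: E_def a_def y_def)
  moreover have "(\<Sum>i\<in>{0..<int p}. E (0 - int q - i)) = 0"
    using Q_pos by (intro sum.neutral) (auto intro!: E_negative)
  ultimately show "\<bar>c 0\<bar> = 1" by (simp add: c_def)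
qed auto

end

section \<open>Choice of the primes and conclusion\<close>

lemma prime_in_progression_greater:
  fixes a m N :: nat
  assumes "m > 0" "coprime a m"
  obtains p where "prime p" "[p = a] (mod m)" "p > N"
  using dirichlet_primes_in_arithmetic_progressions[OF assms]
  by (auto simp: infinite_nat_iff_unbounded)

lemma ternary_primes_exist:
  fixes p L K N :: nat
  assumes "p \<ge> 3" "0 < L" "L < p" "0 < K" and LK: "[L * K = 1] (mod p)"
  obtains q r where "prime q" "prime r" "q > N" "r > N" "coprime p q" "coprime q r" "coprime r p"
    "ternary_polynomial p q r (int K) (int L)"
proof -
  have "coprime (L * K) p" using cong_imp_coprime[of 1 "L * K" p] LK by (simp add: cong_sym)
  then have "coprime K p" by simp
  \<comment> \<open>The lower bound also yields the size condition of the locale, and q > K, so that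
    K stays invertible modulo p q.\<close>
  then obtain q where q: "prime q" "[q = K] (mod p)" "q > N + K * p + K + 2"
    using prime_in_progression_greater[of p K "N + K * p + K + 2"] assms by auto
  have pq: "coprime p q"
    using cong_imp_coprime[of K q p] q(2) \<open>coprime K p\<close> by (simp add: cong_sym coprime_commute)
  have "\<not> q dvd K" using q(3) assms(4) by (auto dest: dvd_imp_le)
  then have "coprime K q" using prime_imp_coprime[OF q(1)] by (simp add: coprime_commute)
  then have "coprime K (p * q)" using \<open>coprime K p\<close> by simp
  from cong_solve_coprime_nat[OF this] obtain b where b: "[K * b = 1] (mod p * q)" by auto
  then have "coprime (K * b) (p * q)" using cong_imp_coprime[of 1 "K * b" "p * q"] by (simp add: cong_sym)
  then have "coprime b (p * q)" by simp
  moreover have "p * q > 0" using assms(1) q(3) by simp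
  ultimately obtain r where r: "prime r" "[r = b] (mod p * q)" "r > N + p + q"
    using prime_in_progression_greater[of "p * q" b "N + p + q"] by auto
  have "coprime r (p * q)" 
    using cong_imp_coprime[of b r "p * q"] r(2) \<open>coprime b (p * q)\<close> by (simp add: cong_sym)
  then have rp: "coprime r p" "coprime q r" by (simp_all add: coprime_commute)
  have LQ: "[L * q = 1] (mod p)"
    using cong_trans[OF cong_scalar_left[OF q(2)] LK] .
  have KR: "[K * r = 1] (mod p * q)"
    using cong_trans[OF cong_scalar_left[OF r(2)] b] .
  have int_cong: "(int x * int y) mod int m = 1" if "[x * y = 1] (mod m)" "m > 1" for x y m :: nat
  proof -
    have "x * y mod m = 1" using that by (simp add: cong_def)
    then have "int (x * y mod m) = 1" by simp
    then show ?thesis by (simp add: of_nat_mod)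
  qed
  have "1 * q \<le> p * q" using assms(1) by (intro mult_le_mono1) auto
  then have "p * q > 1" using q(3) by linarith
  have "ternary_polynomial p q r (int K) (int L)"
  proof
    show "int K * int p + 2 \<le> int q"
    proof -
      have "int (K * p + 2) \<le> int q" using q(3) by (simp only: of_nat_le_iff)
      then show ?thesis by simp
    qed
    show "int K * int r mod (int p * int q) = 1"
      using int_cong[OF KR \<open>p * q > 1\<close>] by simp
  qed (use assms int_cong[OF LQ] int_cong[OF LK] r in auto)
  then show ?thesis using that[of q r] q r pq rp by simp
qed

theorem corollary5:
  fixes p h :: nat
  assumes "p \<ge> 3"
    and "h \<ge> 1"
    and "h = 1 \<or>
      (coprime (h - 1) p \<and>
        ((odd p \<and> 2 \<le> h \<and> h \<le> (p + 1) div 2) \<or>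
         (\<exists>k l. (p = 4 * l \<or> p = 4 * l + 2) \<and> h = 2 * k \<and> 1 \<le> k \<and> k \<le> l)))"
  shows "\<forall>N::nat. \<exists>q r. prime q \<and> prime r \<and> q > N \<and> r > N \<and>
    coprime p q \<and> coprime q r \<and> coprime r p \<and>
    ternary_height p q r = int h"
proof
  fix N :: nat
  show "\<exists>q r. prime q \<and> prime r \<and> q > N \<and> r > N \<and>
    coprime p q \<and> coprime q r \<and> coprime r p \<and> ternary_height p q r = int h"
  proof (cases "h = 1")
    case True
    obtain q r where qr: "prime q" "prime r" "q > N" "r > N" "coprime p q" "coprime q r" "coprime r p"
      "ternary_polynomial p q r (int 1) (int 1)"
      using ternary_primes_exist[of p 1 1 N] assms(1) by auto
    then interpret ternary_polynomial p q r "int 1" "int 1" by simp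
    show ?thesis using qr ternary_height_eq_1 True by auto
  next
    case False
    then have h: "coprime (h - 1) p" "2 \<le> h" using assms(3) by auto
    \<comment> \<open>Both ranges of the theorem give 2 h - 1 <= p: for odd p directly, for even p
      from h = 2k <= 2l.\<close>
    have h_le: "2 * (h - 1) + 1 \<le> p"
    proof (cases "odd p")
      case True
      then have "h \<le> (p + 1) div 2" using assms(3) \<open>h \<noteq> 1\<close> by auto
      then show ?thesis using h(2) by linarith
    next
      case even: False
      then obtain k l where "p = 4 * l \<or> p = 4 * l + 2" "h = 2 * k" "k \<le> l"
        using assms(3) \<open>h \<noteq> 1\<close> by auto
      then show ?thesis using h(2) by linarith
    qed
    obtain k where k: "[(h - 1) * k = 1] (mod p)" using cong_solve_coprime_nat[OF h(1)] by auto
    \<comment> \<open>Adding p keeps the inverse class and ensures K > p, as \<open>k mod p\<close>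
      is nonzero; this supplies p < K L.\<close>
    define K where "K = k mod p + p"
    have LK: "[(h - 1) * K = 1] (mod p)"
      using k by (simp add: K_def cong_def mod_mult_right_eq distrib_left)
    have "k mod p \<noteq> 0"
    proof
      assume "k mod p = 0"
      then have "((h - 1) * k) mod p = 0" by (metis mod_0 mod_mult_right_eq mult_0_right)
      then show False using k assms(1) by (simp add: cong_def)
    qed
    then have "p < K * 1" by (simp add: K_def)
    also have "\<dots> \<le> K * (h - 1)" using h by (intro mult_left_mono) auto
    finally have "int p < int (K * (h - 1))" by (simp only: of_nat_less_iff)
    then have KL: "int p < int K * int (h - 1)" by (simp only: of_nat_mult)
    obtain q r where qr: "prime q" "prime r" "q > N" "r > N" "coprime p q" "coprime q r" "coprime r p"
      "ternary_polynomial p q r (int K) (int (h - 1))"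
      using ternary_primes_exist[of p "h - 1" K N] assms(1) h h_le LK \<open>p < K * 1\<close> by auto
    then interpret ternary_polynomial p q r "int K" "int (h - 1)" by simp
    have "2 * int (h - 1) + 1 \<le> int p" using h h_le by linarith
    from ternary_height_eq_Suc[OF KL this] have "ternary_height p q r = int h" using h by simp
    then show ?thesis using qr by blast
  qed
qed

end
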